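(* Let $\langle X,\tau\rangle$ be a $T_3$ space and let $\mu$ be a cardinal such that every point $p\in X$ has an open neighbourhood $G\in\tau$ with $|G|\le\mu$. If there is no strongly inaccessible cardinal less than or equal to $\mu$, then $X$ has a Noetherian base.
   Context: A base $\mathcal B$ of a topological space is a Noetherian base if it contains no infinite strictly $\subseteq$-increasing sequence. A cardinal is strongly inaccessible if it is uncountable, regular and a strong limit. *)

theory Defs
  imports "HOL-Analysis.Analysis"
begin

definition is_base :: "'a topology \<Rightarrow> 'a set set \<Rightarrow> bool" where
  "is_base X B \<longleftrightarrow> (\<forall>V\<in>B. openin X V) \<and>
     (\<forall>U. openin X U \<longrightarrow> (\<forall>x\<in>U. \<exists>V\<in>B. x \<in> V \<and> V \<subseteq> U))"

definition noetherian_family :: "'a set set \<Rightarrow> bool" where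
  "noetherian_family B \<longleftrightarrow>
     \<not> (\<exists>f :: nat \<Rightarrow> 'a set. (\<forall>n. f n \<in> B) \<and> (\<forall>n. f n \<subset> f (Suc n)))"

definition noetherian_base :: "'a topology \<Rightarrow> 'a set set \<Rightarrow> bool" where
  "noetherian_base X B \<longleftrightarrow> is_base X B \<and> noetherian_family B"

definition T3_space :: "'a topology \<Rightarrow> bool" where
  "T3_space X \<longleftrightarrow> t1_space X \<and> regular_space X"

definition strongly_inaccessible :: "'b rel \<Rightarrow> bool" where
  "strongly_inaccessible k \<longleftrightarrow> Card_order k \<and>
     (card_of (UNIV :: nat set), k) \<in> ordLess \<and>
     regularCard k \<and>
     (\<forall>L :: 'b set. (card_of L, k) \<in> ordLess \<longrightarrow> (card_of (Pow L), k) \<in> ordLess)"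

end

theory Submission
  imports Defs
begin

text \<open>
  Every point \<open>p\<close> and neighbourhood \<open>U\<close> of \<open>p\<close> is assigned an open \<open>V p U\<close> with \<open>p \<in> V p U \<subseteq> U\<close> such that no
  sequence of sets \<open>V (p n) (U n)\<close> with distinct \<open>p n\<close> is increasing; a Noetherian base is then
  selected from these sets.  The sets \<open>V p U\<close> carry labels, written into them by removing
  a closed set; along an increasing sequence the label is constant on a subsequence.  A neighbourhood
  with \<open>\<kappa>\<close> points carries \<open>\<kappa>\<close> labels, and one with a discrete subset of size \<open>\<nu>\<close> carries \<open>2\<^sup>\<nu>\<close> labels.

  The assignment is constructed by induction on \<open>\<theta>\<close> for the points having a neighbourhood with fewer
  than \<open>\<theta>\<close> points.  If \<open>\<theta>\<close> is singular, \<open>cf \<theta>\<close> labels reduce it to smaller cardinals.  If \<open>\<theta>\<close> is regular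
  and uncountable, it is not a strong limit; let \<open>\<nu>\<close> be least with \<open>\<theta> \<le> 2\<^sup>\<nu>\<close>.  Near large discrete sets
  there are \<open>\<theta>\<close> labels, enough to give the points of every small neighbourhood a colour other than that
  of its centre.  Elsewhere all discrete sets are smaller than \<open>\<nu>\<close>, neighbourhoods are
  controlled by their traces on discrete sets, and the subsets of size at most \<open>\<tau>\<close> of an
  arbitrary set can be labelled with \<open>2\<^sup>\<tau>\<close> labels so that comparable sets with the same label are equal.
\<close>

text \<open>Good assignments on an increasing union of pieces do not combine by themselves: a chain
  may meet infinitely many pieces, and the index of the piece must be readable from the open set
  alone. This takes as many labels as pieces, and every neighbourhood must have room for them. For
  singular \<theta> a short cofinal sequence indexes the pieces, and points whose neighbourhoods
  have too little room fall to the induction hypothesis. For regular \<theta> there are more pieces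
  than points in any available neighbourhood, so labels have to come from sets of points; hence the
  need for some \<nu> < \<theta> with 2^\<nu> at least \<theta>, exactly what an inaccessible
  \<theta> lacks. Minimality of \<nu> and regularity of \<theta> keep the supremum of all 2^\<tau>
  with \<tau> < \<nu> below \<theta>, so the points with fewer neighbours than this supremum are
  again covered by induction, and elsewhere that many labels are available. Regularity of the space
  enters through closures: a right-separated set has a dense discrete subset D and at most 2^|D|
  points.\<close>

unbundle cardinal_syntax

subsection \<open>Cardinals and well-orders\<close>

lemma lepoll_iff_card_of: "A \<lesssim> B \<longleftrightarrow> |A| \<le>o |B|"
  by (simp add: lepoll_def card_of_ordLeq[symmetric] image_subset_iff_funcset)

lemma lesspoll_iff_card_of: "A \<prec> B \<longleftrightarrow> |A| <o |B|"
  unfolding lesspoll_def lepoll_iff_card_of eqpoll_iff_card_of_ordIso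
  using ordLeq_iff_ordLess_or_ordIso not_ordLess_ordIso by blast

lemma not_lepoll: "\<not> A \<lesssim> B \<longleftrightarrow> B \<prec> A"
  unfolding lepoll_iff_card_of lesspoll_iff_card_of
  by (simp add: card_of_Well_order not_ordLeq_iff_ordLess)

lemma wf_lesspoll: "wf {(A, B). A \<prec> B}"
proof -
  have "{(A, B). A \<prec> B} = inv_image ordLess card_of"
    by (auto simp: lesspoll_iff_card_of inv_image_def)
  then show ?thesis using wf_inv_image[OF wf_ordLess] by metis
qed

lemma times_self_lepoll: "infinite A \<Longrightarrow> A \<times> A \<lesssim> A"
  by (simp add: card_of_Times_same_infinite eqpoll_iff_card_of_ordIso eqpoll_imp_lepoll)

lemma infinite_lepoll: "infinite A \<Longrightarrow> A \<lesssim> B \<Longrightarrow> infinite B"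
  using finite_lepoll_infinite lepoll_antisym
  by (metis infinite_le_lepoll lepoll_trans)

lemma Times_bool_lepoll: "infinite A \<Longrightarrow> A \<times> (UNIV::bool set) \<lesssim> A"
proof -
  assume A: "infinite A"
  have "(UNIV::bool set) \<lesssim> A" by (simp add: A finite_lepoll_infinite)
  then have "A \<times> (UNIV::bool set) \<lesssim> A \<times> A" by (intro times_lepoll_mono) auto
  then show ?thesis using lepoll_trans times_self_lepoll[OF A] by blast
qed

lemma insert_lesspoll_infinite:
  assumes "infinite B" "A \<prec> B"
  shows "insert x A \<prec> B"
proof (cases "finite A")
  case True
  then show ?thesis using assms(1) by (simp add: finite_lesspoll_infinite)
next
  case False
  then show ?thesis using assms(2) by (rule eq_lesspoll_trans[OF infinite_insert_eqpoll])
qed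

lemma lepoll_UN:
  assumes "infinite B" "I \<lesssim> B" "\<And>i. i \<in> I \<Longrightarrow> A i \<lesssim> B"
  shows "(\<Union>i\<in>I. A i) \<lesssim> B"
  using assms card_of_UNION_ordLeq_infinite unfolding lepoll_iff_card_of by blast

lemma exists_subset_eqpoll: "A \<lesssim> B \<Longrightarrow> \<exists>C\<subseteq>B. C \<approx> A"
  by (metis inj_on_image_eqpoll_self lepoll_def)

lemma Pow_lepoll_mono: "A \<lesssim> B \<Longrightarrow> Pow A \<lesssim> Pow B"
proof -
  assume "A \<lesssim> B"
  then obtain f where "inj_on f A" "f ` A \<subseteq> B" by (auto simp: lepoll_def)
  then have "inj_on (image f) (Pow A)" "image f ` Pow A \<subseteq> Pow B"
    by (auto intro: inj_on_image_Pow)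
  then show ?thesis unfolding lepoll_def by blast
qed

text \<open>Well-foundedness and transitivity are global, and only comparability is tied to
  \<open>K\<close>. The relation thus passes to subsets and pulls back along injections without
  being restricted.\<close>

definition strict_wo :: "('a \<times> 'a) set \<Rightarrow> 'a set \<Rightarrow> bool" where
  "strict_wo R K \<longleftrightarrow> wf R \<and> trans R \<and> (\<forall>x\<in>K. \<forall>y\<in>K. x = y \<or> (x, y) \<in> R \<or> (y, x) \<in> R)"

lemma strict_woD:
  assumes "strict_wo R K"
  shows "wf R" "trans R" "\<And>x y. x \<in> K \<Longrightarrow> y \<in> K \<Longrightarrow> x \<noteq> y \<Longrightarrow> (x, y) \<notin> R \<Longrightarrow> (y, x) \<in> R"
    "\<And>x. (x, x) \<notin> R" "\<And>x y. (x, y) \<in> R \<Longrightarrow> (y, x) \<notin> R"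
  using assms unfolding strict_wo_def by (auto dest: wf_not_sym wf_not_refl)

lemma strict_wo_inv_image:
  assumes "strict_wo R K" "f ` Y \<subseteq> K" "inj_on f Y"
  shows "strict_wo (inv_image R f) Y"
  using assms unfolding strict_wo_def inj_on_def
  by (auto intro: trans_inv_image) blast

lemma strict_wo_least:
  assumes "strict_wo R K" "S \<subseteq> K" "S \<noteq> {}"
  obtains x where "x \<in> S" "\<And>y. y \<in> S \<Longrightarrow> y = x \<or> (x, y) \<in> R"
proof -
  obtain x where "x \<in> S" "\<And>y. (y, x) \<in> R \<Longrightarrow> y \<notin> S"
    using strict_woD(1)[OF assms(1)] assms(3) by (meson ex_in_conv wf_eq_minimal)
  moreover have "y = x \<or> (x, y) \<in> R" if "y \<in> S" for y
    using that calculation assms unfolding strict_wo_def by blast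
  ultimately show thesis using that by blast
qed

text \<open>The well-order \<open>|K|\<close> has the least possible order type, so up to bijection
  its proper segments represent exactly the cardinals below that of \<open>K\<close>. In this way
  elements of \<open>K\<close> index smaller cardinals.\<close>

definition card_less :: "'a set \<Rightarrow> ('a \<times> 'a) set" where
  "card_less K = |K| - Id"

lemma card_less_subset: "card_less K \<subseteq> K \<times> K"
  using Field_card_of[of K] unfolding card_less_def Field_def by auto

lemma strict_wo_card_less: "strict_wo (card_less K) K"
proof -
  have w: "well_order_on K |K|" by (rule card_of_well_order_on)
  then have "trans |K|" "antisym |K|" "total_on K |K|" "wf ( |K| - Id)"
    unfolding well_order_on_def linear_order_on_def partial_order_on_def preorder_on_def by auto
  then show ?thesis unfolding strict_wo_def card_less_def total_on_def
    by (auto simp: trans_diff_Id)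
qed

lemma underS_card_of: "underS |K| x = {y. (y, x) \<in> card_less K}"
  unfolding underS_def card_less_def by auto

lemma card_less_lesspoll: "x \<in> K \<Longrightarrow> {y. (y, x) \<in> card_less K} \<prec> K"
  using card_of_underS[of "|K|" x] unfolding lesspoll_iff_card_of underS_card_of
  by (simp add: Field_card_of card_of_card_order_on)

lemma lesspoll_card_less:
  assumes "A \<prec> K"
  obtains x where "x \<in> K" "A \<approx> {y. (y, x) \<in> card_less K}"
proof -
  have "|A| <o |K|" using assms lesspoll_iff_card_of by blast
  then have "\<exists>x\<in>K. |A| =o Restr |K| (underS |K| x)"
    by (simp only: ordLess_iff_ordIso_Restr[OF card_of_Well_order card_of_Well_order] Field_card_of)
  then obtain x where x: "x \<in> K" "|A| =o Restr |K| (underS |K| x)" ..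
  have wr: "wo_rel |K|" by (simp add: card_of_Well_order wo_rel_def)
  have "Field (Restr |K| (underS |K| x)) = underS |K| x"
    using Field_Restr_ofilter[OF card_of_Well_order wo_rel.underS_ofilter[OF wr]] by blast
  moreover have "|Field |A| | =o |Field (Restr |K| (underS |K| x))|"
    using x(2) by (rule card_of_cong)
  ultimately have "A \<approx> underS |K| x" by (simp add: Field_card_of eqpoll_iff_card_of_ordIso)
  then show thesis using that x(1) underS_card_of[of K x] by simp
qed

text \<open>\<open>cardSuc |A|\<close> lives on another type. Copying it into \<open>K\<close> keeps
  the induction on cardinals within one type; \<open>'b\<close> is left free so that
  \<open>S\<close> can also be compared with sets of points.\<close>

lemma ex_cardSuc_subset:
  fixes A :: "'a set" and K :: "'k set"
  assumes "A \<prec> K"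
  obtains S where "S \<subseteq> K" "A \<prec> S" "\<forall>B::'b set. B \<prec> S \<longrightarrow> B \<lesssim> A" "infinite A \<longrightarrow> regularCard |S|"
proof -
  have c: "Card_order |A|" by (rule card_of_Card_order)
  have "cardSuc |A| \<le>o |K|"
    using assms lesspoll_iff_card_of cardSuc_least[OF c card_of_Card_order] by blast
  moreover have f: "|Field (cardSuc |A| )| =o cardSuc |A|" by (simp add: c cardSuc_Card_order card_of_Field_ordIso)
  ultimately have "Field (cardSuc |A| ) \<lesssim> K" unfolding lepoll_iff_card_of using ordIso_ordLeq_trans by blast
  then obtain S where S: "S \<subseteq> K" "S \<approx> Field (cardSuc |A| )" using exists_subset_eqpoll by blast
  then have e: "|S| =o cardSuc |A|" unfolding eqpoll_iff_card_of_ordIso using f ordIso_transitive by blast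
  have "A \<prec> S" unfolding lesspoll_iff_card_of
    using cardSuc_greater[OF c] e ordIso_symmetric ordLess_ordIso_trans by blast
  moreover have "B \<lesssim> A" if "B \<prec> S" for B :: "'b set"
    using that e unfolding lesspoll_iff_card_of lepoll_iff_card_of
    using cardSuc_ordLeq_ordLess[OF c card_of_Card_order] ordLess_ordIso_trans by blast
  moreover have "regularCard |S|" if i: "infinite A"
  proof -
    have "regularCard (cardSuc |A| )"
      by (rule infinite_cardSuc_regularCard) (use i c in \<open>auto simp: Field_card_of\<close>)
    moreover have "Cinfinite (cardSuc |A| )"
      by (rule Cinfinite_cardSuc) (use i c in \<open>auto simp: cinfinite_def Field_card_of\<close>)
    ultimately show ?thesis using regularCard_ordIso[OF ordIso_symmetric[OF e]] by blast
  qed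
  ultimately show thesis using that S(1) by blast
qed

lemma cofinal_card_of: "cofinal A |K| \<longleftrightarrow> (\<forall>x\<in>K. \<exists>a\<in>A. (x, a) \<in> card_less K)"
  unfolding cofinal_def card_less_def by (auto simp: Field_card_of)

lemma Fpow_lepoll: "infinite A \<Longrightarrow> Fpow A \<lesssim> A"
proof -
  assume A: "infinite A"
  define P where "P n = {S. S \<subseteq> A \<and> finite S \<and> card S = n}" for n
  have "P n \<lesssim> A" for n
  proof (induction n)
    case 0
    have "P 0 = {{}}" by (auto simp: P_def)
    then show ?case using A by (simp add: finite_lepoll_infinite)
  next
    case (Suc n)
    have "P (Suc n) \<subseteq> (\<lambda>(x, S). insert x S) ` (A \<times> P n)"
    proof
      fix S assume "S \<in> P (Suc n)"
      then have S: "S \<subseteq> A" "finite S" "card S = Suc n" by (auto simp: P_def)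
      then obtain x T where "S = insert x T" "x \<notin> T" "card T = n" by (auto simp: card_Suc_eq)
      then show "S \<in> (\<lambda>(x, S). insert x S) ` (A \<times> P n)" using S
        by (auto simp: P_def intro!: image_eqI[of _ _ "(x, T)"])
    qed
    then have "P (Suc n) \<lesssim> A \<times> P n" by (rule subset_image_lepoll)
    also have "A \<times> P n \<lesssim> A \<times> A" using Suc by (intro times_lepoll_mono) auto
    also have "A \<times> A \<lesssim> A" using A by (rule times_self_lepoll)
    finally show ?case .
  qed
  then have "(\<Union>n\<in>(UNIV::nat set). P n) \<lesssim> A"
    using A by (intro lepoll_UN) (auto simp: infinite_le_lepoll[symmetric])
  moreover have "Fpow A = (\<Union>n. P n)" by (auto simp: P_def Fpow_def)
  ultimately show ?thesis by simp
qed

subsection \<open>Neighbourhood selectors and labels\<close>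

definition selector :: "'a topology \<Rightarrow> 'a set \<Rightarrow> ('a \<Rightarrow> 'a set \<Rightarrow> 'a set) \<Rightarrow> bool" where
  "selector X P V \<longleftrightarrow> (\<forall>p\<in>P. \<forall>U. openin X U \<and> p \<in> U \<longrightarrow>
     openin X (V p U) \<and> p \<in> V p U \<and> V p U \<subseteq> U)"

definition nbhd_seq :: "'a topology \<Rightarrow> 'a set \<Rightarrow> (nat \<Rightarrow> 'a) \<Rightarrow> (nat \<Rightarrow> 'a set) \<Rightarrow> bool" where
  "nbhd_seq X P p U \<longleftrightarrow> inj p \<and> (\<forall>n. p n \<in> P \<and> openin X (U n) \<and> p n \<in> U n)"

text \<open>
  The chain condition is only required for pairwise distinct centres: chains with a fixed centre are
  dealt with by thinning out the local bases.
\<close>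

definition noetherian_on :: "'a topology \<Rightarrow> 'a set \<Rightarrow> bool" where
  "noetherian_on X P \<longleftrightarrow> (\<exists>V. selector X P V \<and>
     (\<forall>p U. nbhd_seq X P p U \<longrightarrow> \<not> incseq (\<lambda>n. V (p n) (U n))))"

lemma selectorD:
  assumes "selector X P V" "p \<in> P" "openin X U" "p \<in> U"
  shows "openin X (V p U)" "p \<in> V p U" "V p U \<subseteq> U"
  using assms unfolding selector_def by blast+

lemma nbhd_seqD:
  assumes "nbhd_seq X P p U"
  shows "inj p" "p n \<in> P" "openin X (U n)" "p n \<in> U n"
  using assms unfolding nbhd_seq_def by blast+

section \<open>Chains and their subsequences\<close>

lemma nbhd_seq_subseq:
  "nbhd_seq X P p U \<Longrightarrow> strict_mono g \<Longrightarrow> nbhd_seq X P (\<lambda>n. p (g n)) (\<lambda>n. U (g n))"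
  unfolding nbhd_seq_def by (auto simp: inj_def) (metis strict_mono_eq)

lemma incseq_subseq: "incseq A \<Longrightarrow> strict_mono g \<Longrightarrow> incseq (\<lambda>n. A (g n))"
  unfolding mono_def by (simp add: strict_mono_less_eq)

lemma infinite_subseq:
  fixes S :: "nat set"
  assumes "infinite S"
  obtains g where "strict_mono (g :: nat \<Rightarrow> nat)" "\<And>n. g n \<in> S"
  using infinite_enumerate[OF assms] by metis

lemma finite_range_subseq:
  fixes f :: "nat \<Rightarrow> 'b"
  assumes "finite (range f)"
  obtains g c where "strict_mono (g :: nat \<Rightarrow> nat)" "\<And>n. f (g n) = c"
proof -
  have "\<exists>a\<in>UNIV. infinite {b\<in>UNIV. f b = f a}"
    by (rule pigeonhole_infinite) (use assms in auto)
  then obtain a where "infinite {b. f b = f a}" by auto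
  then obtain g where "strict_mono (g :: nat \<Rightarrow> nat)" "\<And>n. g n \<in> {b. f b = f a}" using infinite_subseq by metis
  then show thesis using that[of g "f a"] by simp
qed

lemma const_or_inj_subseq:
  fixes p :: "nat \<Rightarrow> 'b"
  obtains g c where "strict_mono (g :: nat \<Rightarrow> nat)" "\<And>n. p (g n) = c"
  | g where "strict_mono (g :: nat \<Rightarrow> nat)" "inj (\<lambda>n. p (g n))"
proof (cases "finite (range p)")
  case True
  then obtain g c where "strict_mono (g :: nat \<Rightarrow> nat)" "\<And>n. p (g n) = c"
    using finite_range_subseq[of p] by blast
  then show ?thesis by (rule that(1))
next
  case False
  \<comment> \<open>The first occurrences of the values: \<open>p\<close> is injective on
    \<open>S\<close> and loses no value there.\<close>
  define S where "S = {n. \<forall>m<n. p m \<noteq> p n}"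
  have "range p \<subseteq> p ` S"
  proof safe
    fix n
    obtain k where k: "p k = p n" "\<And>m. m < k \<Longrightarrow> p m \<noteq> p n"
      using exists_least_iff[of "\<lambda>m. p m = p n"] by blast
    then have "k \<in> S" by (simp add: S_def)
    then show "p n \<in> p ` S" using k(1) by (metis imageI)
  qed
  then have "infinite S" using False finite_surj by metis
  then obtain g where g: "strict_mono (g :: nat \<Rightarrow> nat)" "\<And>n. g n \<in> S" using infinite_subseq by metis
  have "inj (\<lambda>n. p (g n))"
  proof (rule injI)
    have *: "p (g m) \<noteq> p (g n)" if "m < n" for m n
      using g(2)[of n] strict_monoD[OF g(1) that] by (auto simp: S_def)
    show "m = n" if "p (g m) = p (g n)" for m n
      using *[of m n] *[of n m] that by (metis linorder_neqE_nat)
  qed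
  then show ?thesis by (rule that(2)[OF g(1)])
qed

text \<open>Keep a set when it contains no set that is earlier in a fixed well-order. A strictly
  increasing sequence of kept sets would descend in this well-order.\<close>

lemma noetherian_refinement:
  obtains N where "N \<subseteq> A" "\<And>B. B \<in> A \<Longrightarrow> \<exists>C\<in>N. C \<subseteq> B" "noetherian_family N"
proof -
  define R where "R = card_less A"
  have R: "strict_wo R A" unfolding R_def by (rule strict_wo_card_less)
  define N where "N = {B\<in>A. \<forall>C\<in>A. (C, B) \<in> R \<longrightarrow> \<not> C \<subseteq> B}"
  show thesis
  proof
    show "N \<subseteq> A" by (auto simp: N_def)
    show "\<exists>C\<in>N. C \<subseteq> B" if B: "B \<in> A" for B
    proof -
      obtain C where C: "C \<in> {C\<in>A. C \<subseteq> B}" "\<And>D. D \<in> {C\<in>A. C \<subseteq> B} \<Longrightarrow> D = C \<or> (C, D) \<in> R"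
        by (rule strict_wo_least[OF R, of "{C\<in>A. C \<subseteq> B}"]) (use B in auto)
      have "\<not> D \<subseteq> C" if "D \<in> A" "(D, C) \<in> R" for D
      proof
        assume "D \<subseteq> C"
        then have "D = C \<or> (C, D) \<in> R" using C that by blast
        then show False using that(2) strict_woD(4,5)[OF R] by blast
      qed
      then show ?thesis using C(1) by (auto simp: N_def)
    qed
    show "noetherian_family N"
      unfolding noetherian_family_def
    proof
      assume "\<exists>f. (\<forall>n. f n \<in> N) \<and> (\<forall>n. f n \<subset> f (Suc n))"
      then obtain f :: "nat \<Rightarrow> _" where f: "\<And>n. f n \<in> N" "\<And>n. f n \<subset> f (Suc n)" by blast
      have "(f (Suc n), f n) \<in> R" for n
      proof -
        have "(f n, f (Suc n)) \<notin> R" using f(1)[of "Suc n"] f(1)[of n] f(2)[of n] by (auto simp: N_def)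
        moreover have "f n \<in> A" "f (Suc n) \<in> A" using f(1) by (auto simp: N_def)
        ultimately show ?thesis using f(2)[of n] strict_woD(3)[OF R] by blast
      qed
      then show False using strict_woD(1)[OF R] unfolding wf_iff_no_infinite_down_chain by blast
    qed
  qed
qed

text \<open>The refined families are still local bases, because all their members come from the
  selector and so contain the point. A subsequence of a chain has constant or distinct centres: the
  refinement at one point excludes the former, the selector the latter.\<close>

lemma noetherian_base_if_noetherian_on_topspace:
  assumes "noetherian_on X (topspace X)"
  shows "\<exists>B. noetherian_base X B"
proof -
  obtain V where V: "selector X (topspace X) V"
    "\<And>p U. nbhd_seq X (topspace X) p U \<Longrightarrow> \<not> incseq (\<lambda>n. V (p n) (U n))"
    using assms unfolding noetherian_on_def by blast
  define A where "A p = {V p U | U. openin X U \<and> p \<in> U}" for p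
  have "\<forall>p. \<exists>N. N \<subseteq> A p \<and> (\<forall>B\<in>A p. \<exists>C\<in>N. C \<subseteq> B) \<and> noetherian_family N"
    using noetherian_refinement by metis
  then obtain N where N: "\<And>p. N p \<subseteq> A p" "\<And>p B. B \<in> A p \<Longrightarrow> \<exists>C\<in>N p. C \<subseteq> B"
    "\<And>p. noetherian_family (N p)" by metis
  let ?B = "\<Union>p\<in>topspace X. N p"
  have "is_base X ?B" unfolding is_base_def
  proof (intro conjI allI impI ballI)
    fix W assume "W \<in> ?B"
    then show "openin X W" using N(1) selectorD(1)[OF V(1)] unfolding A_def by blast
  next
    fix U x assume U: "openin X U" "x \<in> U"
    then have x: "x \<in> topspace X" using openin_subset by blast
    have "V x U \<in> A x" using U by (auto simp: A_def)
    then obtain C where C: "C \<in> N x" "C \<subseteq> V x U" using N(2) by blast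
    then have "x \<in> C" using N(1) selectorD(2)[OF V(1) x] unfolding A_def by blast
    moreover have "C \<subseteq> U" using C(2) selectorD(3)[OF V(1) x U] by blast
    ultimately show "\<exists>W\<in>?B. x \<in> W \<and> W \<subseteq> U" using C(1) x by blast
  qed
  moreover have "noetherian_family ?B" unfolding noetherian_family_def
  proof
    assume "\<exists>f. (\<forall>n. f n \<in> ?B) \<and> (\<forall>n. f n \<subset> f (Suc n))"
    then obtain f :: "nat \<Rightarrow> _" where f: "\<And>n. f n \<in> ?B" "\<And>n. f n \<subset> f (Suc n)" by blast
    then have "\<forall>n. \<exists>p\<in>topspace X. f n \<in> N p" by blast
    then obtain p where p: "\<And>n. p n \<in> topspace X" "\<And>n. f n \<in> N (p n)" by metis
    have sm: "strict_mono f" using f(2) by (simp add: strict_mono_Suc_iff)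
    show False
    proof (rule const_or_inj_subseq[of p])
      fix g c assume g: "strict_mono (g :: nat \<Rightarrow> nat)" "\<And>n. p (g n) = c"
      have "f (g n) \<subset> f (g (Suc n))" for n
        using sm g(1) unfolding strict_mono_def by auto
      moreover have "f (g n) \<in> N c" for n using p(2)[of "g n"] g(2) by simp
      ultimately have "\<not> noetherian_family (N c)" unfolding noetherian_family_def
        by (intro notI, elim notE) (rule exI[of _ "\<lambda>n. f (g n)"], simp)
      then show False using N(3) by blast
    next
      fix g assume g: "strict_mono (g :: nat \<Rightarrow> nat)" "inj (\<lambda>n. p (g n))"
      have "\<forall>n. \<exists>U. openin X U \<and> p n \<in> U \<and> f n = V (p n) U"
        using p(2) N(1) unfolding A_def by blast
      then obtain U where U: "\<And>n. openin X (U n)" "\<And>n. p n \<in> U n" "\<And>n. f n = V (p n) (U n)" by metis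
      have "nbhd_seq X (topspace X) (\<lambda>n. p (g n)) (\<lambda>n. U (g n))"
        using g(2) U p(1) by (auto simp: nbhd_seq_def)
      moreover have "incseq (\<lambda>n. V (p (g n)) (U (g n)))"
        using incseq_subseq[OF strict_mono_mono[OF sm] g(1)] U(3) by simp
      ultimately show False using V(2)[of "\<lambda>n. p (g n)" "\<lambda>n. U (g n)"] by blast
    qed
  qed
  ultimately show ?thesis unfolding noetherian_base_def by blast
qed

lemma noetherian_on_subset: "noetherian_on X P \<Longrightarrow> Q \<subseteq> P \<Longrightarrow> noetherian_on X Q"
proof -
  assume "noetherian_on X P" "Q \<subseteq> P"
  then obtain V where V: "selector X P V" "\<And>p U. nbhd_seq X P p U \<Longrightarrow> \<not> incseq (\<lambda>n. V (p n) (U n))"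
    unfolding noetherian_on_def by blast
  have "selector X Q V" using V(1) \<open>Q \<subseteq> P\<close> unfolding selector_def by auto
  moreover have "nbhd_seq X P p U" if "nbhd_seq X Q p U" for p U
    using that \<open>Q \<subseteq> P\<close> unfolding nbhd_seq_def by auto
  ultimately show ?thesis using V(2) unfolding noetherian_on_def by blast
qed

text \<open>Every chain has a subsequence whose centres stay on one side, so two selectors can be
  glued without any compatibility.\<close>

lemma noetherian_on_Un:
  assumes "noetherian_on X P" "noetherian_on X Q"
  shows "noetherian_on X (P \<union> Q)"
proof -
  obtain V where V: "selector X P V" "\<And>p U. nbhd_seq X P p U \<Longrightarrow> \<not> incseq (\<lambda>n. V (p n) (U n))"
    using assms unfolding noetherian_on_def by blast
  obtain W where W: "selector X Q W" "\<And>p U. nbhd_seq X Q p U \<Longrightarrow> \<not> incseq (\<lambda>n. W (p n) (U n))"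
    using assms unfolding noetherian_on_def by blast
  define Z where "Z p = (if p \<in> P then V p else W p)" for p
  have "\<not> incseq (\<lambda>n. Z (p n) (U n))" if s: "nbhd_seq X (P \<union> Q) p U" for p U
  proof
    assume inc: "incseq (\<lambda>n. Z (p n) (U n))"
    have "finite (range (\<lambda>n. p n \<in> P))" by (rule finite_subset[of _ UNIV]) auto
    then obtain g c where g: "strict_mono (g :: nat \<Rightarrow> nat)" "\<And>n. (p (g n) \<in> P) = c"
      using finite_range_subseq[of "\<lambda>n. p n \<in> P"] by blast
    have i: "incseq (\<lambda>n. Z (p (g n)) (U (g n)))" using incseq_subseq[OF inc g(1)] .
    have q: "nbhd_seq X (P \<union> Q) (\<lambda>n. p (g n)) (\<lambda>n. U (g n))" using nbhd_seq_subseq[OF s g(1)] .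
    show False
    proof (cases c)
      case True
      then have "nbhd_seq X P (\<lambda>n. p (g n)) (\<lambda>n. U (g n))" using q g(2) by (auto simp: nbhd_seq_def)
      moreover have "incseq (\<lambda>n. V (p (g n)) (U (g n)))" using i True g(2) by (simp add: Z_def)
      ultimately show False using V(2)[of "\<lambda>n. p (g n)" "\<lambda>n. U (g n)"] by blast
    next
      case False
      then have "nbhd_seq X Q (\<lambda>n. p (g n)) (\<lambda>n. U (g n))" using q g(2) by (auto simp: nbhd_seq_def)
      moreover have "incseq (\<lambda>n. W (p (g n)) (U (g n)))" using i False g(2) by (simp add: Z_def)
      ultimately show False using W(2)[of "\<lambda>n. p (g n)" "\<lambda>n. U (g n)"] by blast
    qed
  qed
  moreover have "selector X (P \<union> Q) Z"
    unfolding selector_def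
  proof (intro ballI allI impI)
    fix p U assume "p \<in> P \<union> Q" "openin X U \<and> p \<in> U"
    then show "openin X (Z p U) \<and> p \<in> Z p U \<and> Z p U \<subseteq> U"
      using selectorD[OF V(1), of p U] selectorD[OF W(1), of p U] by (cases "p \<in> P") (simp_all add: Z_def)
  qed
  ultimately show ?thesis unfolding noetherian_on_def by blast
qed

text \<open>The selected set meets \<open>P\<close> only in its centre, while in a chain it would
  also contain the centres of all earlier terms.\<close>

lemma noetherian_on_relatively_discrete:
  assumes "\<And>p. p \<in> P \<Longrightarrow> \<exists>U. openin X U \<and> p \<in> U \<and> U \<inter> P = {p}"
  shows "noetherian_on X P"
proof -
  obtain G where G: "\<And>p. p \<in> P \<Longrightarrow> openin X (G p) \<and> p \<in> G p \<and> G p \<inter> P = {p}"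
    using assms by metis
  have "\<not> incseq (\<lambda>n. U n \<inter> G (p n))" if s: "nbhd_seq X P p U" for p U
  proof
    assume "incseq (\<lambda>n. U n \<inter> G (p n))"
    then have "U 0 \<inter> G (p 0) \<subseteq> U 1 \<inter> G (p 1)" by (simp add: incseq_def)
    then have "p 0 \<in> G (p 1) \<inter> P" using G nbhd_seqD[OF s] by blast
    then have "p 0 = p 1" using G nbhd_seqD(2)[OF s] by blast
    then show False using nbhd_seqD(1)[OF s] by (simp add: inj_eq)
  qed
  moreover have "selector X P (\<lambda>p U. U \<inter> G p)"
    unfolding selector_def using G by (simp add: openin_Int)
  ultimately show ?thesis unfolding noetherian_on_def by (intro exI[of _ "\<lambda>p U. U \<inter> G p"] conjI) auto
qed

text \<open>
  A label \<open>s\<close> is attached to a neighbourhood by deleting the closed set \<open>K s b\<close> from it.  There are two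
  copies, indexed by \<open>b\<close>, so that one of them misses the centre.  By the last clause finitely many of
  the sets cannot cover another one; this makes the label readable from the remaining open set.
\<close>

definition label_box :: "'a topology \<Rightarrow> 't set \<Rightarrow> ('t \<Rightarrow> bool \<Rightarrow> 'a set) \<Rightarrow> bool" where
  "label_box X T K \<longleftrightarrow> (\<forall>s\<in>T. \<forall>b. closedin X (K s b)) \<and> (\<forall>s\<in>T. K s True \<inter> K s False = {}) \<and>
     (\<forall>s\<in>T. \<forall>b F. finite F \<and> F \<subseteq> T \<times> UNIV \<and> K s b \<subseteq> (\<Union>(t, c)\<in>F. K t c) \<longrightarrow> (s, b) \<in> F)"

text \<open>
  The box used for a neighbourhood \<open>V\<close> is the first one (in a fixed well-order) that lies in \<open>V\<close> up to
  finitely many of its sets.  Deleting one of these sets does not change this choice, and the choice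
  can only move down when \<open>V\<close> grows.
\<close>

lemma box_labelling:
  fixes lab :: "'j \<Rightarrow> 't" and W :: "'j \<Rightarrow> 'a set"
  assumes W: "\<And>j. j \<in> J \<Longrightarrow> openin X (W j) \<and> pt j \<in> W j \<and> lab j \<in> T"
    and boxes: "\<And>K. K \<in> \<B> \<Longrightarrow> label_box X T K"
    and avail: "\<And>j. j \<in> J \<Longrightarrow> \<exists>K\<in>\<B>. (\<Union>s\<in>T. \<Union>b. K s b) \<subseteq> W j"
  obtains S where "\<And>j. j \<in> J \<Longrightarrow> openin X (W j - S j) \<and> pt j \<in> W j - S j"
    "\<And>j. j \<in> J \<Longrightarrow> \<exists>K\<in>\<B>. \<exists>s\<in>T. \<exists>b. S j = K s b"
    "\<And>f. (\<And>n. f n \<in> J) \<Longrightarrow> incseq (\<lambda>n. W (f n) - S (f n)) \<Longrightarrow>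
       \<exists>g s S0. strict_mono (g :: nat \<Rightarrow> nat) \<and> (\<forall>n. lab (f (g n)) = s \<and> S (f (g n)) = S0)"
proof -
  define R where "R = card_less \<B>"
  have R: "strict_wo R \<B>" unfolding R_def by (rule strict_wo_card_less)
  define tot where "tot K = (\<Union>s\<in>T. \<Union>b. K s b)" for K :: "'t \<Rightarrow> bool \<Rightarrow> 'a set"
  define A where "A V = {K\<in>\<B>. \<exists>F. finite F \<and> F \<subseteq> T \<times> UNIV \<and> tot K - V \<subseteq> (\<Union>(t, c)\<in>F. K t c)}"
    for V
  have A_mono: "A V \<subseteq> A V'" if "V \<subseteq> V'" for V V'
  proof
    fix K assume "K \<in> A V"
    then obtain F where "K \<in> \<B>" "finite F" "F \<subseteq> T \<times> UNIV" "tot K - V \<subseteq> (\<Union>(t, c)\<in>F. K t c)"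
      unfolding A_def by blast
    moreover have "tot K - V' \<subseteq> tot K - V" using that by blast
    ultimately show "K \<in> A V'" unfolding A_def by (auto intro!: exI[of _ F])
  qed
  define z where "z V = (SOME K. K \<in> A V \<and> (\<forall>L\<in>A V. L = K \<or> (K, L) \<in> R))" for V
  have z: "z V \<in> A V \<and> (\<forall>L\<in>A V. L = z V \<or> (z V, L) \<in> R)" if ne: "A V \<noteq> {}" for V
  proof -
    have "A V \<subseteq> \<B>" by (auto simp: A_def)
    then obtain K where "K \<in> A V" "\<And>L. L \<in> A V \<Longrightarrow> L = K \<or> (K, L) \<in> R"
      using strict_wo_least[OF R _ ne] by metis
    then have "\<exists>K. K \<in> A V \<and> (\<forall>L\<in>A V. L = K \<or> (K, L) \<in> R)" by blast
    then show ?thesis unfolding z_def by (rule someI_ex)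
  qed
  have z_eq: "z V = z V'" if "A V \<subseteq> A V'" "z V' \<in> A V" for V V'
  proof -
    have "A V \<noteq> {}" "A V' \<noteq> {}" using that by auto
    then have "z V' = z V \<or> (z V, z V') \<in> R" "z V = z V' \<or> (z V', z V) \<in> R" "z V \<in> A V"
      using z that by blast+
    then show ?thesis using strict_woD(5)[OF R] by metis
  qed
  have Wne: "z (W j) \<in> A (W j)" if j: "j \<in> J" for j
  proof -
    obtain K where "K \<in> \<B>" "tot K \<subseteq> W j" using avail[OF j] unfolding tot_def by blast
    then have "K \<in> A (W j)" unfolding A_def by (auto intro!: exI[of _ "{}"])
    then show ?thesis using z by blast
  qed
  define c where "c j = (SOME b. pt j \<notin> z (W j) (lab j) b)" for j
  have bx: "label_box X T (z (W j))" if "j \<in> J" for j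
    using Wne[OF that] boxes by (auto simp: A_def)
  have c: "pt j \<notin> z (W j) (lab j) (c j)" if "j \<in> J" for j
  proof -
    have "z (W j) (lab j) True \<inter> z (W j) (lab j) False = {}"
      using bx[OF that] W[OF that] unfolding label_box_def by blast
    then have "\<exists>b. pt j \<notin> z (W j) (lab j) b" by blast
    then show ?thesis unfolding c_def by (rule someI_ex)
  qed
  define S where "S j = z (W j) (lab j) (c j)" for j
  have zV: "z (W j - S j) = z (W j) \<and> z (W j) \<in> A (W j - S j)" if j: "j \<in> J" for j
  proof -
    obtain F where F: "finite F" "F \<subseteq> T \<times> UNIV" "tot (z (W j)) - W j \<subseteq> (\<Union>(t, c)\<in>F. z (W j) t c)"
      and zB: "z (W j) \<in> \<B>"
      using Wne[OF j] unfolding A_def by blast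
    have "tot (z (W j)) - (W j - S j) \<subseteq> (\<Union>(t, c)\<in>insert (lab j, c j) F. z (W j) t c)"
      using F(3) unfolding S_def by auto
    moreover have "insert (lab j, c j) F \<subseteq> T \<times> UNIV" using F(2) W[OF j] by auto
    ultimately have "z (W j) \<in> A (W j - S j)"
      unfolding A_def using zB F(1) by (auto intro!: exI[of _ "insert (lab j, c j) F"])
    then show ?thesis using z_eq[OF A_mono, of "W j - S j" "W j"] by blast
  qed
  show thesis
  proof
    show "openin X (W j - S j) \<and> pt j \<in> W j - S j" if "j \<in> J" for j
      using bx[OF that] W[OF that] c[OF that] unfolding label_box_def S_def by (auto intro!: openin_diff)
    show "\<exists>K\<in>\<B>. \<exists>s\<in>T. \<exists>b. S j = K s b" if "j \<in> J" for j
      using Wne[OF that] W[OF that] unfolding S_def A_def by blast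
    fix f :: "nat \<Rightarrow> 'j"
    assume f: "\<And>n. f n \<in> J" and inc: "incseq (\<lambda>n. W (f n) - S (f n))"
    let ?V = "\<lambda>n. W (f n) - S (f n)"
    have zA: "z (?V n) \<in> A (?V n)" for n using zV[OF f] by metis
    then have zB: "range (\<lambda>n. z (?V n)) \<subseteq> \<B>" by (auto simp: A_def)
    \<comment> \<open>The chosen boxes only move down along the chain, so they equal the least of
      them, \<open>K\<close>, from some \<open>n0\<close> on.\<close>
    obtain K where "K \<in> range (\<lambda>n. z (?V n))" and
      K: "\<And>L. L \<in> range (\<lambda>n. z (?V n)) \<Longrightarrow> L = K \<or> (K, L) \<in> R"
      using strict_wo_least[OF R zB] by blast
    then obtain n0 where n0: "K = z (?V n0)" by blast
    have zK: "z (?V n) = K" if "n0 \<le> n" for n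
    proof -
      have "?V n0 \<subseteq> ?V n" using inc that by (simp add: incseq_def)
      then have "K \<in> A (?V n)" using zA[of n0] A_mono n0 by blast
      then have "K = z (?V n) \<or> (z (?V n), K) \<in> R" using z by blast
      moreover have "z (?V n) = K \<or> (K, z (?V n)) \<in> R" using K by blast
      ultimately show ?thesis using strict_woD(5)[OF R] by metis
    qed
    obtain F where F: "finite F" "F \<subseteq> T \<times> UNIV" "tot K - ?V n0 \<subseteq> (\<Union>(t, c)\<in>F. K t c)"
      using zA[of n0] n0 unfolding A_def by blast
    have zW: "z (W (f n)) = K" if "n0 \<le> n" for n using zK[OF that] zV[OF f[of n]] by simp
    \<comment> \<open>\<open>S (f n)\<close> is disjoint from the \<open>n\<close>-th set of the
      chain, hence from the \<open>n0\<close>-th, so \<open>F\<close> covers it. The last clause of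
      \<open>label_box\<close> then confines all later labels to the finite set
      \<open>F\<close>.\<close>
    have inF: "(lab (f n), c (f n)) \<in> F" if n: "n0 \<le> n" for n
    proof -
      have S: "S (f n) = K (lab (f n)) (c (f n))" using zW[OF n] by (simp add: S_def)
      have "S (f n) \<subseteq> tot K" using S W[OF f[of n]] unfolding tot_def by blast
      moreover have "?V n0 \<subseteq> ?V n" using inc n by (simp add: incseq_def)
      ultimately have "K (lab (f n)) (c (f n)) \<subseteq> (\<Union>(t, c)\<in>F. K t c)" using S F(3) by blast
      then show ?thesis using bx[OF f[of n]] zW[OF n] F(1,2) W[OF f[of n]] unfolding label_box_def by blast
    qed
    have "finite (range (\<lambda>n. (lab (f (n0 + n)), c (f (n0 + n)))))"
      using inF by (intro finite_subset[OF _ F(1)]) auto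
    then obtain g sc where g: "strict_mono (g :: nat \<Rightarrow> nat)"
      "\<And>n. (lab (f (n0 + g n)), c (f (n0 + g n))) = sc"
      using finite_range_subseq[of "\<lambda>n. (lab (f (n0 + n)), c (f (n0 + n)))"] by blast
    show "\<exists>g s S0. strict_mono (g :: nat \<Rightarrow> nat) \<and> (\<forall>n. lab (f (g n)) = s \<and> S (f (g n)) = S0)"
    proof (intro exI conjI allI)
      show "strict_mono (\<lambda>n. n0 + g n)" using g(1) by (simp add: strict_mono_def)
      fix n
      show "lab (f (n0 + g n)) = fst sc" using g(2)[of n] by auto
      show "S (f (n0 + g n)) = K (fst sc) (snd sc)"
        using g(2)[of n] zW[of "n0 + g n"] by (auto simp: S_def)
    qed
  qed
qed

text \<open>Here a box consists of single points, two for each label; it fits into every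
  neighbourhood because \<open>T\<close> is infinite and embeds there. Along a chain the deleted
  point is eventually the same and can be put back, so only chains of \<open>W\<close> with a
  constant label remain to be excluded.\<close>

lemma noetherian_on_by_labels:
  fixes lab :: "'a \<Rightarrow> 'a set \<Rightarrow> 't"
  assumes X: "t1_space X" and P: "P \<subseteq> topspace X" and T: "infinite T"
    and big: "\<And>p U. p \<in> P \<Longrightarrow> openin X U \<Longrightarrow> p \<in> U \<Longrightarrow> T \<lesssim> U"
    and W: "selector X P W"
    and lab: "\<And>p U. p \<in> P \<Longrightarrow> openin X U \<Longrightarrow> p \<in> U \<Longrightarrow> lab p U \<in> T"
    and no: "\<And>p U s. nbhd_seq X P p U \<Longrightarrow> incseq (\<lambda>n. W (p n) (U n)) \<Longrightarrow>
      (\<And>n. lab (p n) (U n) = s) \<Longrightarrow> False"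
  shows "noetherian_on X P"
proof -
  define J where "J = {(p, U). p \<in> P \<and> openin X U \<and> p \<in> U}"
  define \<B> where "\<B> = {\<lambda>s b. {f (s, b)} | f. inj_on f (T \<times> (UNIV::bool set)) \<and> f ` (T \<times> UNIV) \<subseteq> topspace X}"
  have b: "label_box X T K" if "K \<in> \<B>" for K
  proof -
    obtain f where f: "K = (\<lambda>s b. {f (s, b)})" "inj_on f (T \<times> (UNIV::bool set))" "f ` (T \<times> UNIV) \<subseteq> topspace X"
      using \<open>K \<in> \<B>\<close> unfolding \<B>_def by blast
    show ?thesis unfolding label_box_def
    proof (intro conjI ballI allI impI)
      show "closedin X (K s b)" if "s \<in> T" for s b
        using X f(3) that unfolding f(1) by (simp add: t1_space_closedin_singleton image_subset_iff)
      show "K s True \<inter> K s False = {}" if "s \<in> T" for s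
        using inj_onD[OF f(2), of "(s, True)" "(s, False)"] that by (auto simp: f(1))
      show "(s, b) \<in> F" if "s \<in> T" "finite F \<and> F \<subseteq> T \<times> UNIV \<and> K s b \<subseteq> (\<Union>(t, c)\<in>F. K t c)" for s b F
      proof -
        have "f (s, b) \<in> f ` F" using that(2) unfolding f(1) by auto
        then obtain x where "x \<in> F" "f (s, b) = f x" by blast
        moreover have "x \<in> T \<times> UNIV" using calculation that by blast
        ultimately have "(s, b) = x" using inj_onD[OF f(2), of "(s, b)" x] that by auto
        then show ?thesis using \<open>x \<in> F\<close> by simp
      qed
    qed
  qed
  have av: "\<exists>K\<in>\<B>. (\<Union>s\<in>T. \<Union>b. K s b) \<subseteq> W (fst j) (snd j)" if "j \<in> J" for j
  proof -
    have j: "fst j \<in> P" "openin X (snd j)" "fst j \<in> snd j" using that by (auto simp: J_def)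
    have "T \<times> (UNIV::bool set) \<lesssim> T" using T by (rule Times_bool_lepoll)
    also have "T \<lesssim> W (fst j) (snd j)" using selectorD[OF W j] big j(1) by blast
    finally obtain f where f: "inj_on f (T \<times> (UNIV::bool set))" "f ` (T \<times> UNIV) \<subseteq> W (fst j) (snd j)"
      unfolding lepoll_def by blast
    have "W (fst j) (snd j) \<subseteq> topspace X" using selectorD(1)[OF W j] openin_subset by blast
    then have "(\<lambda>s b. {f (s, b)}) \<in> \<B>" using f unfolding \<B>_def by blast
    moreover have "(\<Union>s\<in>T. \<Union>b. {f (s, b)}) \<subseteq> W (fst j) (snd j)" using f(2) by auto
    ultimately show ?thesis by (intro bexI)
  qed
  have op: "openin X (W (fst j) (snd j)) \<and> fst j \<in> W (fst j) (snd j) \<and> lab (fst j) (snd j) \<in> T"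
    if "j \<in> J" for j using that selectorD[OF W] lab by (auto simp: J_def)
  show ?thesis
  proof (rule box_labelling[of J X "\<lambda>j. W (fst j) (snd j)" fst "\<lambda>j. lab (fst j) (snd j)" T \<B>, OF op b av])
    fix S assume S: "\<And>j. j \<in> J \<Longrightarrow> openin X (W (fst j) (snd j) - S j) \<and> fst j \<in> W (fst j) (snd j) - S j"
      "\<And>j. j \<in> J \<Longrightarrow> \<exists>K\<in>\<B>. \<exists>s\<in>T. \<exists>b. S j = K s b"
      "\<And>f. (\<And>n. f n \<in> J) \<Longrightarrow> incseq (\<lambda>n. W (fst (f n)) (snd (f n)) - S (f n)) \<Longrightarrow>
         \<exists>g s S0. strict_mono (g :: nat \<Rightarrow> nat) \<and> (\<forall>n. lab (fst (f (g n))) (snd (f (g n))) = s \<and> S (f (g n)) = S0)"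
    define V where "V p U = W p U - S (p, U)" for p U
    have "selector X P V" unfolding selector_def V_def
      using S(1)[unfolded J_def] selectorD[OF W] by fastforce
    moreover have "\<not> incseq (\<lambda>n. V (p n) (U n))" if s: "nbhd_seq X P p U" for p U
    proof
      assume inc: "incseq (\<lambda>n. V (p n) (U n))"
      have J: "(p n, U n) \<in> J" for n using nbhd_seqD[OF s] by (auto simp: J_def)
      have "\<exists>g s S0. strict_mono (g :: nat \<Rightarrow> nat) \<and> (\<forall>n. lab (p (g n)) (U (g n)) = s \<and> S (p (g n), U (g n)) = S0)"
        using S(3)[of "\<lambda>n. (p n, U n)"] J inc by (simp add: V_def)
      then obtain g t S0 where g: "strict_mono (g :: nat \<Rightarrow> nat)" "\<And>n. lab (p (g n)) (U (g n)) = t"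
        "\<And>n. S (p (g n), U (g n)) = S0" by blast
      obtain x where x: "S0 = {x}" using S(2)[OF J[of "g 0"]] g(3)[of 0] unfolding \<B>_def by auto
      \<comment> \<open>A box lies in \<open>W\<close> only up to finitely many of its points, so
        the deleted point may or may not belong to \<open>W\<close>. A second subsequence makes this
        uniform, and along it the sets \<open>W\<close> themselves increase.\<close>
      have "finite (range (\<lambda>n. x \<in> W (p (g n)) (U (g n))))" by (rule finite_subset[of _ UNIV]) auto
      then obtain h c where h: "strict_mono (h :: nat \<Rightarrow> nat)" "\<And>n. (x \<in> W (p (g (h n))) (U (g (h n)))) = c"
        using finite_range_subseq[of "\<lambda>n. x \<in> W (p (g n)) (U (g n))"] by blast
      let ?k = "\<lambda>n. g (h n)"
      have k: "strict_mono ?k" using g(1) h(1) by (simp add: strict_mono_def)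
      have "incseq (\<lambda>n. V (p (?k n)) (U (?k n)))" by (rule incseq_subseq[OF inc k])
      then have "incseq (\<lambda>n. W (p (?k n)) (U (?k n)) - {x})" using g(3) x by (simp add: V_def)
      then have "incseq (\<lambda>n. W (p (?k n)) (U (?k n)))"
        using h(2) unfolding incseq_def by blast
      then show False using no[OF nbhd_seq_subseq[OF s k]] g(2) by blast
    qed
    ultimately show "noetherian_on X P" unfolding noetherian_on_def by blast
  qed
qed

text \<open>The label names a piece containing the centre, so the centres of a chain with constant
  label all lie in one piece.\<close>

lemma noetherian_on_UN:
  fixes T :: "'t set"
  assumes X: "t1_space X" and P: "P \<subseteq> topspace X" and T: "infinite T"
    and big: "\<And>p U. p \<in> P \<Longrightarrow> openin X U \<Longrightarrow> p \<in> U \<Longrightarrow> T \<lesssim> U"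
    and sub: "P \<subseteq> (\<Union>t\<in>T. Q t)" and Q: "\<And>t. t \<in> T \<Longrightarrow> noetherian_on X (Q t)"
  shows "noetherian_on X P"
proof -
  obtain V where V: "\<And>t. t \<in> T \<Longrightarrow> selector X (Q t) (V t)"
    "\<And>t p U. t \<in> T \<Longrightarrow> nbhd_seq X (Q t) p U \<Longrightarrow> \<not> incseq (\<lambda>n. V t (p n) (U n))"
    using Q unfolding noetherian_on_def by metis
  obtain \<tau> where \<tau>: "\<And>p. p \<in> P \<Longrightarrow> \<tau> p \<in> T \<and> p \<in> Q (\<tau> p)" using sub by (metis UN_E subsetD)
  show ?thesis
  proof (rule noetherian_on_by_labels[OF X P T big, where W="\<lambda>p. V (\<tau> p) p" and lab="\<lambda>p U. \<tau> p"])
    show "selector X P (\<lambda>p. V (\<tau> p) p)" using V(1) \<tau> unfolding selector_def by metis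
    fix p U s assume s: "nbhd_seq X P p U" "incseq (\<lambda>n. V (\<tau> (p n)) (p n) (U n))" "\<And>n. \<tau> (p n) = s"
    then have "nbhd_seq X (Q s) p U" "s \<in> T" using \<tau> unfolding nbhd_seq_def by metis+
    then show False using V(2) s by simp
  qed (use \<tau> in auto)
qed

lemma pairing_ex:
  assumes "infinite T"
  obtains pr where "\<And>a b. a \<in> T \<Longrightarrow> b \<in> T \<Longrightarrow> pr a b \<in> T"
    "\<And>a b c d. a \<in> T \<Longrightarrow> b \<in> T \<Longrightarrow> c \<in> T \<Longrightarrow> d \<in> T \<Longrightarrow> pr a b = pr c d \<Longrightarrow> a = c \<and> b = d"
proof -
  obtain f where f: "inj_on f (T \<times> T)" "f ` (T \<times> T) \<subseteq> T"
    using times_self_lepoll[OF assms] unfolding lepoll_def by blast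
  show thesis
  proof (rule that[of "\<lambda>a b. f (a, b)"])
    show "f (a, b) \<in> T" if "a \<in> T" "b \<in> T" for a b using f(2) that by blast
    show "a = c \<and> b = d" if "a \<in> T" "b \<in> T" "c \<in> T" "d \<in> T" "f (a, b) = f (c, d)" for a b c d
      using inj_onD[OF f(1) that(5)] that(1-4) by simp
  qed
qed

text \<open>If points were moved down, the least such point \<open>x\<close> would give the smaller
  point \<open>f x\<close>, which is moved down as well.\<close>

lemma strict_wo_no_descent:
  assumes R: "strict_wo R K" and B: "B \<subseteq> K" "\<And>b. b \<in> B \<Longrightarrow> f b \<in> B"
    and mono: "\<And>b b'. b \<in> B \<Longrightarrow> b' \<in> B \<Longrightarrow> (b, b') \<in> R \<Longrightarrow> (f b, f b') \<in> R"
    and b: "b \<in> B"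
  shows "(f b, b) \<notin> R"
proof
  assume "(f b, b) \<in> R"
  then have ne: "{b\<in>B. (f b, b) \<in> R} \<noteq> {}" using b by blast
  obtain x where x: "x \<in> {b\<in>B. (f b, b) \<in> R}"
    "\<And>y. y \<in> {b\<in>B. (f b, b) \<in> R} \<Longrightarrow> y = x \<or> (x, y) \<in> R"
    using strict_wo_least[OF R _ ne] B(1) by blast
  have "(f (f x), f x) \<in> R" using x(1) mono B(2) by blast
  then have "f x = x \<or> (x, f x) \<in> R" using x B(2) by blast
  then show False using x(1) strict_woD(4,5)[OF R] by (metis mem_Collect_eq)
qed

subsection \<open>Labelling small sets\<close>

text \<open>
  Induction on \<open>|K|\<close>.  A set bounded in the initial well-order of \<open>K\<close> is labelled by its order type and
  by the label it has inside its least bound: if \<open>A \<subseteq> B\<close> have different least bounds, then \<open>A\<close> lies below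
  some element of \<open>B\<close>, so that the order types differ.  An unbounded set is labelled by the labels of
  its traces on the members of one fixed small cofinal set \<open>C0\<close>.
\<close>

lemma proper_labelling:
  fixes F :: "'f set" and T :: "'t set" and K :: "'k set" and cf :: "('f \<Rightarrow> 't) \<Rightarrow> 't"
  assumes T: "infinite T"
    and cf: "\<And>f. (\<And>u. u \<in> F \<Longrightarrow> f u \<in> T) \<Longrightarrow> cf f \<in> T"
    and cf_inj: "\<And>f f' u. (\<And>u. u \<in> F \<Longrightarrow> f u \<in> T) \<Longrightarrow> (\<And>u. u \<in> F \<Longrightarrow> f' u \<in> T) \<Longrightarrow>
      cf f = cf f' \<Longrightarrow> u \<in> F \<Longrightarrow> f u = f' u"
  shows "\<exists>l :: 'k set \<Rightarrow> 't. (\<forall>A. A \<subseteq> K \<and> A \<lesssim> F \<longrightarrow> l A \<in> T) \<and>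
    (\<forall>A B. A \<subseteq> B \<and> B \<subseteq> K \<and> B \<lesssim> F \<and> l A = l B \<longrightarrow> A = B)"
proof (induction K rule: wf_induct_rule[OF wf_lesspoll])
  case (1 K)
  obtain pr where pr: "\<And>a b. a \<in> T \<Longrightarrow> b \<in> T \<Longrightarrow> pr a b \<in> T"
    and pr_inj: "\<And>a b c d. a \<in> T \<Longrightarrow> b \<in> T \<Longrightarrow> c \<in> T \<Longrightarrow> d \<in> T \<Longrightarrow> pr a b = pr c d \<Longrightarrow> a = c \<and> b = d"
    using pairing_ex[OF T] by metis
  obtain t0 where t0: "t0 \<in> T" using T by (metis ex_in_conv finite.emptyI)
  obtain t1 where t1: "t1 \<in> T" "t0 \<noteq> t1" using T by (metis finite.emptyI finite_insert infinite_super insertI1 subsetI)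
  show ?case
  proof (cases "K \<lesssim> T")
    case True
    then obtain e where e: "inj_on e K" "e ` K \<subseteq> T" unfolding lepoll_def by blast
    have "\<exists>h. h ` F = A" if "A \<noteq> {}" "A \<lesssim> F" for A :: "'k set"
      using that card_of_ordLeq2 unfolding lepoll_iff_card_of by metis
    then obtain h where h: "\<And>A :: 'k set. A \<noteq> {} \<Longrightarrow> A \<lesssim> F \<Longrightarrow> h A ` F = A" by metis
    \<comment> \<open>A nonempty set is coded completely, by a function from \<open>F\<close> onto
      it. The empty set has no such function and is told apart by its first component
      \<open>t0\<close>.\<close>
    define l where "l A = (if A = {} then pr t0 t0 else pr t1 (cf (\<lambda>u. e (h A u))))" for A
    have eT: "e (h A u) \<in> T" if "A \<subseteq> K" "A \<noteq> {}" "A \<lesssim> F" "u \<in> F" for A u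
      using that h[of A] e(2) by blast
    have "l A \<in> T" if "A \<subseteq> K" "A \<lesssim> F" for A
      unfolding l_def using that pr t0 t1 cf eT by simp
    moreover have "A = B" if AB: "A \<subseteq> B" "B \<subseteq> K" "B \<lesssim> F" "l A = l B" for A B
    proof (cases "A = {}")
      case True
      show ?thesis
      proof (rule ccontr)
        assume "A \<noteq> B"
        then have B: "B \<noteq> {}" using True by auto
        then have "pr t0 t0 = pr t1 (cf (\<lambda>u. e (h B u)))" using AB True by (simp add: l_def)
        moreover have "cf (\<lambda>u. e (h B u)) \<in> T" using AB B eT cf by simp
        ultimately show False using pr_inj[OF t0 t0 t1(1)] t1(2) by blast
      qed
    next
      case False
      then have B: "B \<noteq> {}" using AB by auto
      have A: "A \<subseteq> K" "A \<lesssim> F" using AB by (auto intro: lepoll_trans[OF subset_imp_lepoll])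
      have c: "cf (\<lambda>u. e (h A u)) \<in> T" "cf (\<lambda>u. e (h B u)) \<in> T"
        using AB B A False eT cf by simp_all
      then have "cf (\<lambda>u. e (h A u)) = cf (\<lambda>u. e (h B u))"
        using AB(4) False B pr_inj[OF t1(1) c(1) t1(1) c(2)] by (simp add: l_def)
      then have "e (h A u) = e (h B u)" if "u \<in> F" for u
        using cf_inj[of "\<lambda>u. e (h A u)" "\<lambda>u. e (h B u)" u] eT A AB False B that by simp
      moreover have "h A u \<in> K" "h B u \<in> K" if "u \<in> F" for u
        using that h[OF False A(2)] h[OF B AB(3)] A AB by blast+
      ultimately have "h A u = h B u" if "u \<in> F" for u
        using e(1) that by (simp add: inj_on_def)
      then have "h A ` F = h B ` F" by (rule image_cong[OF refl])
      then show ?thesis using h[OF False A(2)] h[OF B AB(3)] by simp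
    qed
    ultimately show ?thesis by (intro exI[of _ l]) simp
  next
    case False
    then have TK: "T \<prec> K" by (simp add: not_lepoll)
    then have K: "infinite K" using T infinite_lepoll lesspoll_imp_lepoll by metis
    define R where "R = card_less K"
    have R: "strict_wo R K" unfolding R_def by (rule strict_wo_card_less)
    have RK: "R \<subseteq> K \<times> K" unfolding R_def by (rule card_less_subset)
    define I where "I x = insert x {y. (y, x) \<in> R}" for x
    have IK: "I x \<subseteq> K" if "x \<in> K" for x using that RK by (auto simp: I_def)
    have "I x \<prec> K" if "x \<in> K" for x
      unfolding I_def R_def by (rule insert_lesspoll_infinite[OF K card_less_lesspoll[OF that]])
    then have "\<forall>x\<in>K. \<exists>l :: 'k set \<Rightarrow> 't. (\<forall>A. A \<subseteq> I x \<and> A \<lesssim> F \<longrightarrow> l A \<in> T) \<and>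
      (\<forall>A B. A \<subseteq> B \<and> B \<subseteq> I x \<and> B \<lesssim> F \<and> l A = l B \<longrightarrow> A = B)" using 1 by simp
    from bchoice[OF this] obtain lx :: "'k \<Rightarrow> 'k set \<Rightarrow> 't"
      where lx': "\<forall>x\<in>K. (\<forall>A. A \<subseteq> I x \<and> A \<lesssim> F \<longrightarrow> lx x A \<in> T) \<and>
      (\<forall>A B. A \<subseteq> B \<and> B \<subseteq> I x \<and> B \<lesssim> F \<and> lx x A = lx x B \<longrightarrow> A = B)" ..
    have lx: "lx x A \<in> T" if "x \<in> K" "A \<subseteq> I x" "A \<lesssim> F" for x A using lx' that by blast
    have lx_inj: "A = B" if "x \<in> K" "A \<subseteq> B" "B \<subseteq> I x" "B \<lesssim> F" "lx x A = lx x B" for x A B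
      using lx' that by blast
    define s where "s A = (SOME x. x \<in> K \<and> A \<subseteq> I x \<and> (\<forall>y\<in>K. A \<subseteq> I y \<longrightarrow> y = x \<or> (x, y) \<in> R))" for A
    have s: "s A \<in> K \<and> A \<subseteq> I (s A) \<and> (\<forall>y\<in>K. A \<subseteq> I y \<longrightarrow> y = s A \<or> (s A, y) \<in> R)"
      if bd: "\<exists>x\<in>K. A \<subseteq> I x" for A
    proof -
      obtain x where "x \<in> {x\<in>K. A \<subseteq> I x}" "\<And>y. y \<in> {x\<in>K. A \<subseteq> I x} \<Longrightarrow> y = x \<or> (x, y) \<in> R"
        by (rule strict_wo_least[OF R, of "{x\<in>K. A \<subseteq> I x}"]) (use bd in auto)
      then have "\<exists>x. x \<in> K \<and> A \<subseteq> I x \<and> (\<forall>y\<in>K. A \<subseteq> I y \<longrightarrow> y = x \<or> (x, y) \<in> R)" by blast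
      then show ?thesis unfolding s_def by (rule someI_ex)
    qed
    have "\<forall>A :: 'k set. \<exists>g. A \<lesssim> F \<longrightarrow> inj_on g A \<and> g ` A \<subseteq> F"
      unfolding lepoll_def by blast
    from choice[OF this] obtain g where
      g: "\<And>A :: 'k set. A \<lesssim> F \<Longrightarrow> inj_on (g A) A \<and> g A ` A \<subseteq> F" by blast
    \<comment> \<open>\<open>rl A\<close> is the order of \<open>A\<close> copied to
      \<open>F\<close> along \<open>g A\<close>, so that its code \<open>w A\<close> determines the
      order type of \<open>A\<close>.\<close>
    define rl where "rl A u v = (if \<exists>a\<in>A. \<exists>b\<in>A. u = g A a \<and> v = g A b \<and> (a = b \<or> (a, b) \<in> R) then t1 else t0)"
      for A u v
    have rlT: "rl A u v \<in> T" for A u v using t0 t1 by (simp add: rl_def)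
    define w where "w A = cf (\<lambda>u. cf (rl A u))" for A
    have wT: "w A \<in> T" for A unfolding w_def by (intro cf rlT)
    have w_eq: "rl A u v = rl B u v" if "w A = w B" "u \<in> F" "v \<in> F" for A B u v
    proof -
      have "cf (rl A u) = cf (rl B u)"
        using cf_inj[of "\<lambda>u. cf (rl A u)" "\<lambda>u. cf (rl B u)" u] that cf rlT by (simp add: w_def)
      then show ?thesis using cf_inj[of "rl A u" "rl B u" v] that rlT by simp
    qed
    have s_eq: "s A = s B" if AB: "A \<subseteq> B" "B \<subseteq> K" "B \<lesssim> F" "w A = w B" "\<exists>x\<in>K. B \<subseteq> I x" for A B
    proof (rule ccontr)
      assume ne: "s A \<noteq> s B"
      have bA: "\<exists>x\<in>K. A \<subseteq> I x" using AB(1,5) by blast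
      have sA: "s A \<in> K" "A \<subseteq> I (s A)" "\<And>y. y \<in> K \<Longrightarrow> A \<subseteq> I y \<Longrightarrow> y = s A \<or> (s A, y) \<in> R"
        using s[OF bA] by simp_all
      have sB: "s B \<in> K" "B \<subseteq> I (s B)" "\<And>y. y \<in> K \<Longrightarrow> B \<subseteq> I y \<Longrightarrow> y = s B \<or> (s B, y) \<in> R"
        using s[OF AB(5)] by simp_all
      have "(s A, s B) \<in> R" using sA(3)[OF sB(1)] sB(2) AB(1) ne by simp
      then have "\<not> B \<subseteq> I (s A)" using sB(3)[OF sA(1)] ne strict_woD(5)[OF R] by metis
      then obtain b where b: "b \<in> B" "b \<notin> I (s A)" by blast
      then have "(s A, b) \<in> R" using strict_woD(3)[OF R, of b "s A"] AB(2) s[OF bA] by (auto simp: I_def)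
      then have less: "(a, b) \<in> R" if "a \<in> A" for a
        using that s[OF bA] transD[OF strict_woD(2)[OF R]] by (auto simp: I_def)
      have AF: "A \<lesssim> F" using AB by (auto intro: lepoll_trans[OF subset_imp_lepoll])
      have rel: "\<exists>a\<in>A. \<exists>a'\<in>A. g B x = g A a \<and> g B y = g A a' \<and> (a = a' \<or> (a, a') \<in> R)"
        if xy: "x \<in> B" "y \<in> B" "x = y \<or> (x, y) \<in> R" for x y
      proof -
        have "g B x \<in> F" "g B y \<in> F" using g[OF AB(3)] xy by blast+
        then have "rl A (g B x) (g B y) = rl B (g B x) (g B y)" using w_eq[OF AB(4)] by simp
        moreover have "rl B (g B x) (g B y) = t1" using xy unfolding rl_def by auto
        ultimately show ?thesis using t1(2) unfolding rl_def by (simp split: if_splits)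
      qed
      \<comment> \<open>This is \<open>g B\<close> followed by the inverse of \<open>g A\<close>.
        Equal codes make it a strictly increasing map from \<open>B\<close> into \<open>A\<close>,
        and it would move \<open>b\<close> down because all of \<open>A\<close> lies below
        \<open>b\<close>.\<close>
      define f where "f x = (SOME a. a \<in> A \<and> g B x = g A a)" for x
      have f: "f x \<in> A \<and> g B x = g A (f x)" if "x \<in> B" for x
      proof -
        have "\<exists>a. a \<in> A \<and> g B x = g A a" using rel[OF that that] by blast
        then show ?thesis unfolding f_def by (rule someI_ex)
      qed
      have "(f x, f y) \<in> R" if xy: "x \<in> B" "y \<in> B" "(x, y) \<in> R" for x y
      proof -
        obtain a a' where a: "a \<in> A" "a' \<in> A" "g B x = g A a" "g B y = g A a'" "a = a' \<or> (a, a') \<in> R"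
          using rel xy by blast
        then have "f x = a" "f y = a'" using f[OF xy(1)] f[OF xy(2)] g[OF AF] by (metis inj_onD)+
        moreover have "a \<noteq> a'"
        proof
          assume "a = a'"
          then have "x = y" using a xy g[OF AB(3)] by (metis inj_onD)
          then show False using xy(3) strict_woD(4)[OF R] by blast
        qed
        ultimately show ?thesis using a(5) by blast
      qed
      moreover have "f x \<in> B" if "x \<in> B" for x using f[OF that] AB(1) by blast
      ultimately have "(f b, b) \<notin> R" using strict_wo_no_descent[OF R AB(2), of f b] b(1) by blast
      then show False using less f[OF b(1)] by blast
    qed
    \<comment> \<open>If there is no unbounded set of size at most \<open>|F|\<close>, then
      \<open>C0\<close> is arbitrary, but then every set to be labelled is bounded and
      \<open>C0\<close> is never consulted.\<close>
    define C0 where "C0 = (SOME C. C \<subseteq> K \<and> C \<lesssim> F \<and> \<not> (\<exists>x\<in>K. C \<subseteq> I x))"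
    have C0: "C0 \<subseteq> K \<and> C0 \<lesssim> F \<and> \<not> (\<exists>x\<in>K. C0 \<subseteq> I x)"
      if "A \<subseteq> K" "A \<lesssim> F" "\<not> (\<exists>x\<in>K. A \<subseteq> I x)" for A
    proof -
      have "\<exists>C. C \<subseteq> K \<and> C \<lesssim> F \<and> \<not> (\<exists>x\<in>K. C \<subseteq> I x)" using that by (intro exI[of _ A]) simp
      then show ?thesis unfolding C0_def by (rule someI_ex)
    qed
    define h where "h = (SOME h. h ` F = C0)"
    have h: "h ` F = C0" if A: "A \<subseteq> K" "A \<lesssim> F" "\<not> (\<exists>x\<in>K. A \<subseteq> I x)" for A
    proof -
      have "C0 \<noteq> {}" using C0[OF A] K by (metis empty_subsetI ex_in_conv finite.emptyI)
      then have "\<exists>h. h ` F = C0" using C0[OF A] card_of_ordLeq2 unfolding lepoll_iff_card_of by metis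
      then show ?thesis unfolding h_def by (rule someI_ex)
    qed
    define un where "un A u = lx (h u) (A \<inter> I (h u))" for A u
    define l where "l A = (if \<exists>x\<in>K. A \<subseteq> I x then pr t0 (pr (w A) (lx (s A) A)) else pr t1 (cf (un A)))" for A
    have unT: "un A u \<in> T" if A: "A \<subseteq> K" "A \<lesssim> F" and ub: "B \<subseteq> K" "B \<lesssim> F" "\<not> (\<exists>x\<in>K. B \<subseteq> I x)"
      and u: "u \<in> F" for A B u
    proof -
      have "h u \<in> K" using h[OF ub] C0[OF ub] u by blast
      moreover have "A \<inter> I (h u) \<lesssim> F" using A(2) by (rule lepoll_trans[OF subset_imp_lepoll, rotated]) blast
      ultimately show ?thesis unfolding un_def using lx by blast
    qed
    have sT: "lx (s A) A \<in> T" if "A \<lesssim> F" "\<exists>x\<in>K. A \<subseteq> I x" for A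
      using s[OF that(2)] lx that(1) by blast
    have lT: "l A \<in> T" if A: "A \<subseteq> K" "A \<lesssim> F" for A
    proof (cases "\<exists>x\<in>K. A \<subseteq> I x")
      case True
      then show ?thesis unfolding l_def using sT[OF A(2) True] wT t0 pr by simp
    next
      case False
      then have "cf (un A) \<in> T" using unT[OF A A] cf by blast
      then show ?thesis unfolding l_def using False t1 pr by simp
    qed
    have "A = B" if AB: "A \<subseteq> B" "B \<subseteq> K" "B \<lesssim> F" "l A = l B" for A B
    proof -
      have A: "A \<subseteq> K" "A \<lesssim> F" using AB by (auto intro: lepoll_trans[OF subset_imp_lepoll])
      show ?thesis
      proof (cases "\<exists>x\<in>K. B \<subseteq> I x")
        case True
        then have bA: "\<exists>x\<in>K. A \<subseteq> I x" using AB(1) by blast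
        have e: "pr t0 (pr (w A) (lx (s A) A)) = pr t0 (pr (w B) (lx (s B) B))"
          using AB(4) True bA by (simp add: l_def)
        have T': "lx (s A) A \<in> T" "lx (s B) B \<in> T" using sT A AB bA True by blast+
        have "pr (w A) (lx (s A) A) = pr (w B) (lx (s B) B)"
          using pr_inj[OF t0 _ t0 _ e] pr wT T' by blast
        then have "w A = w B" "lx (s A) A = lx (s B) B"
          using pr_inj[OF wT T'(1) wT T'(2)] by blast+
        then show ?thesis using s_eq[OF AB(1-3) _ True] s[OF True] lx_inj[of "s B" A B] AB by simp
      next
        case ub: False
        have TB: "cf (un B) \<in> T" using unT[OF AB(2,3) AB(2,3) ub] cf by blast
        have ubA: "\<not> (\<exists>x\<in>K. A \<subseteq> I x)"
        proof
          assume bA: "\<exists>x\<in>K. A \<subseteq> I x"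
          have "pr t0 (pr (w A) (lx (s A) A)) = pr t1 (cf (un B))"
            using AB(4) bA ub by (simp add: l_def)
          then show False using pr_inj[OF t0 _ t1(1) TB] pr[OF wT sT[OF A(2) bA]] t1(2) by blast
        qed
        have TA: "cf (un A) \<in> T" using unT[OF A A ubA] cf by blast
        have "pr t1 (cf (un A)) = pr t1 (cf (un B))" using AB(4) ub ubA by (simp add: l_def)
        then have "cf (un A) = cf (un B)" using pr_inj[OF t1(1) TA t1(1) TB] by blast
        then have ue: "un A u = un B u" if "u \<in> F" for u
          using cf_inj[of "un A" "un B" u] unT[OF A A ubA] unT[OF AB(2,3) AB(2,3) ub] that by blast
        show ?thesis
        proof (rule ccontr)
          assume "A \<noteq> B"
          then obtain b where b: "b \<in> B" "b \<notin> A" using AB(1) by blast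
          then have bK: "b \<in> K" using AB(2) by blast
          then have "\<not> C0 \<subseteq> I b" using C0[OF A ubA] by blast
          then obtain c where c: "c \<in> C0" "c \<notin> I b" by blast
          then have cK: "c \<in> K" using C0[OF A ubA] by blast
          have "b \<in> I c" using c(2) strict_woD(3)[OF R cK bK] by (auto simp: I_def)
          obtain u where u: "u \<in> F" "h u = c" using h[OF A ubA] c(1) by blast
          have "lx c (A \<inter> I c) = lx c (B \<inter> I c)" using ue[OF u(1)] u(2) by (simp add: un_def)
          moreover have "B \<inter> I c \<lesssim> F" using AB(3) by (rule lepoll_trans[OF subset_imp_lepoll, rotated]) blast
          ultimately have "A \<inter> I c = B \<inter> I c" using lx_inj[OF cK, of "A \<inter> I c" "B \<inter> I c"] AB(1) by blast
          then show False using b \<open>b \<in> I c\<close> by blast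
        qed
      qed
    qed
    then show ?thesis using lT by (intro exI[of _ l]) simp
  qed
qed

text \<open>This is (2^F)^F = 2^(F x F) = 2^F: a function is coded by its graph as a relation on
  \<open>F\<close>, moved into \<open>F\<close> by an injection of pairs.\<close>

lemma function_code_Pow:
  assumes "infinite F"
  obtains cf where "\<And>f. (\<And>u. u \<in> F \<Longrightarrow> f u \<in> Pow F) \<Longrightarrow> cf f \<in> Pow F"
    "\<And>f f' u. (\<And>u. u \<in> F \<Longrightarrow> f u \<in> Pow F) \<Longrightarrow> (\<And>u. u \<in> F \<Longrightarrow> f' u \<in> Pow F) \<Longrightarrow>
      cf f = cf f' \<Longrightarrow> u \<in> F \<Longrightarrow> f u = f' u"
proof -
  obtain j where j: "inj_on j (F \<times> F)" "j ` (F \<times> F) \<subseteq> F"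
    using times_self_lepoll[OF assms] unfolding lepoll_def by blast
  define cf where "cf f = j ` (SIGMA u:F. f u)" for f
  have sub: "(SIGMA u:F. f u) \<subseteq> F \<times> F" if "\<And>u. u \<in> F \<Longrightarrow> f u \<in> Pow F" for f
    using that by blast
  show thesis
  proof (rule that[of cf])
    show "cf f \<in> Pow F" if "\<And>u. u \<in> F \<Longrightarrow> f u \<in> Pow F" for f
      using order_trans[OF image_mono[OF sub[OF that]] j(2)] unfolding cf_def by simp
    show "f u = f' u" if f: "\<And>u. u \<in> F \<Longrightarrow> f u \<in> Pow F" "\<And>u. u \<in> F \<Longrightarrow> f' u \<in> Pow F"
      "cf f = cf f'" "u \<in> F" for f f' u
    proof -
      have "(SIGMA u:F. f u) = (SIGMA u:F. f' u)"
        using inj_on_image_eq_iff[OF j(1) sub[OF f(1)] sub[OF f(2)]] f(3) by (simp add: cf_def)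
      then show ?thesis using f(4) by blast
    qed
  qed
qed

lemma proper_labelling_Pow:
  fixes F :: "'f set" and T :: "'t set" and K :: "'k set"
  assumes T: "infinite T" "Pow F \<lesssim> T"
  shows "\<exists>l :: 'k set \<Rightarrow> 't. (\<forall>A. A \<subseteq> K \<and> A \<lesssim> F \<longrightarrow> l A \<in> T) \<and>
    (\<forall>A B. A \<subseteq> B \<and> B \<subseteq> K \<and> B \<lesssim> F \<and> l A = l B \<longrightarrow> A = B)"
proof (cases "finite F")
  case True
  \<comment> \<open>Comparable finite sets of the same size are equal, so the size serves as the
    label.\<close>
  obtain e :: "nat \<Rightarrow> 't" where e: "inj e" "range e \<subseteq> T" using infinite_countable_subset[OF T(1)] by blast
  have "A = B" if "A \<subseteq> B" "B \<lesssim> F" "e (card A) = e (card B)" for A B :: "'k set"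
  proof -
    have "finite B" using infinite_lepoll[OF _ that(2)] True by blast
    moreover have "card A = card B" using injD[OF e(1) that(3)] .
    ultimately show ?thesis using card_subset_eq[OF _ that(1)] by blast
  qed
  then show ?thesis using e(2) by (intro exI[of _ "\<lambda>A. e (card A)"]) auto
next
  case False
  show ?thesis
  proof (rule function_code_Pow[OF False])
    fix cf assume cf: "\<And>f. (\<And>u. u \<in> F \<Longrightarrow> f u \<in> Pow F) \<Longrightarrow> cf f \<in> Pow F"
      "\<And>f f' u. (\<And>u. u \<in> F \<Longrightarrow> f u \<in> Pow F) \<Longrightarrow> (\<And>u. u \<in> F \<Longrightarrow> f' u \<in> Pow F) \<Longrightarrow>
        cf f = cf f' \<Longrightarrow> u \<in> F \<Longrightarrow> f u = f' u"
    have "infinite (Pow F)" using False by simp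
    have "\<exists>l :: 'k set \<Rightarrow> 'f set. (\<forall>A. A \<subseteq> K \<and> A \<lesssim> F \<longrightarrow> l A \<in> Pow F) \<and>
      (\<forall>A B. A \<subseteq> B \<and> B \<subseteq> K \<and> B \<lesssim> F \<and> l A = l B \<longrightarrow> A = B)"
    proof (rule proper_labelling[where cf=cf])
      show "infinite (Pow F)" by fact
    qed (fact cf)+
    then obtain l :: "'k set \<Rightarrow> 'f set"
      where l: "(\<forall>A. A \<subseteq> K \<and> A \<lesssim> F \<longrightarrow> l A \<in> Pow F) \<and>
        (\<forall>A B. A \<subseteq> B \<and> B \<subseteq> K \<and> B \<lesssim> F \<and> l A = l B \<longrightarrow> A = B)" ..
    obtain e where e: "inj_on e (Pow F)" "e ` Pow F \<subseteq> T" using T(2) unfolding lepoll_def by blast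
    show "\<exists>l :: 'k set \<Rightarrow> 't. (\<forall>A. A \<subseteq> K \<and> A \<lesssim> F \<longrightarrow> l A \<in> T) \<and>
      (\<forall>A B. A \<subseteq> B \<and> B \<subseteq> K \<and> B \<lesssim> F \<and> l A = l B \<longrightarrow> A = B)"
    proof (intro exI[of _ "\<lambda>A. e (l A)"] conjI allI impI)
      show "e (l A) \<in> T" if "A \<subseteq> K \<and> A \<lesssim> F" for A proof -
      have "l A \<in> Pow F" using conjunct1[OF l] that by simp
      then show ?thesis using e(2) by blast
    qed
      show "A = B" if AB: "A \<subseteq> B \<and> B \<subseteq> K \<and> B \<lesssim> F \<and> e (l A) = e (l B)" for A B
      proof -
        have "A \<subseteq> K" "A \<lesssim> F" using AB by (auto intro: lepoll_trans[OF subset_imp_lepoll])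
        then have "l A = l B"
          using inj_onD[OF e(1), of "l A" "l B"] conjunct1[OF l] AB by simp
        then show ?thesis using conjunct2[OF l] AB by metis
      qed
    qed
  qed
qed

text \<open>The sets have no common bound on their size below \<open>|N|\<close>. Their cardinality,
  given by a segment of \<open>N\<close>, becomes part of the label, and for each cardinality the
  bounded case applies.\<close>

lemma proper_labelling_lesspoll:
  fixes N :: "'n set" and T :: "'t set" and K :: "'k set"
  assumes T: "infinite T" "N \<lesssim> T" and N: "\<And>x. x \<in> N \<Longrightarrow> Pow {y. (y, x) \<in> card_less N} \<lesssim> T"
  obtains l :: "'k set \<Rightarrow> 't" where "\<And>A. A \<subseteq> K \<Longrightarrow> A \<prec> N \<Longrightarrow> l A \<in> T"
    "\<And>A B. A \<subseteq> B \<Longrightarrow> B \<subseteq> K \<Longrightarrow> B \<prec> N \<Longrightarrow> l A = l B \<Longrightarrow> A = B"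
proof -
  obtain pr where pr: "\<And>a b. a \<in> T \<Longrightarrow> b \<in> T \<Longrightarrow> pr a b \<in> T"
    and pr_inj: "\<And>a b c d. a \<in> T \<Longrightarrow> b \<in> T \<Longrightarrow> c \<in> T \<Longrightarrow> d \<in> T \<Longrightarrow> pr a b = pr c d \<Longrightarrow> a = c \<and> b = d"
    using pairing_ex[OF T(1)] by metis
  let ?F = "\<lambda>x. {y. (y, x) \<in> card_less N}"
  have "\<forall>x\<in>N. \<exists>l :: 'k set \<Rightarrow> 't. (\<forall>A. A \<subseteq> K \<and> A \<lesssim> ?F x \<longrightarrow> l A \<in> T) \<and>
    (\<forall>A B. A \<subseteq> B \<and> B \<subseteq> K \<and> B \<lesssim> ?F x \<and> l A = l B \<longrightarrow> A = B)"
    using proper_labelling_Pow[OF T(1) N] by blast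
  from bchoice[OF this] obtain l :: "'n \<Rightarrow> 'k set \<Rightarrow> 't" where
    l': "\<forall>x\<in>N. (\<forall>A. A \<subseteq> K \<and> A \<lesssim> ?F x \<longrightarrow> l x A \<in> T) \<and>
    (\<forall>A B. A \<subseteq> B \<and> B \<subseteq> K \<and> B \<lesssim> ?F x \<and> l x A = l x B \<longrightarrow> A = B)" ..
  obtain e where e: "inj_on e N" "e ` N \<subseteq> T" using T(2) unfolding lepoll_def by blast
  define c where "c A = (SOME x. x \<in> N \<and> A \<approx> ?F x)" for A :: "'k set"
  have c: "c A \<in> N \<and> A \<approx> ?F (c A)" if A: "A \<prec> N" for A
  proof -
    obtain x where "x \<in> N" "A \<approx> ?F x" by (rule lesspoll_card_less[OF A])
    then have "\<exists>x. x \<in> N \<and> A \<approx> ?F x" by blast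
    then show ?thesis unfolding c_def by (rule someI_ex)
  qed
  have lT: "l (c A) A \<in> T" if "A \<subseteq> K" "A \<prec> N" for A
    using c[OF that(2)] l' that(1) eqpoll_imp_lepoll by blast
  have eT: "e (c A) \<in> T" if "A \<prec> N" for A using c[OF that] e(2) by blast
  show thesis
  proof (rule that[of "\<lambda>A. pr (e (c A)) (l (c A) A)"])
    show "pr (e (c A)) (l (c A) A) \<in> T" if "A \<subseteq> K" "A \<prec> N" for A
      using pr[OF eT lT] that by blast
    show "A = B" if AB: "A \<subseteq> B" "B \<subseteq> K" "B \<prec> N" "pr (e (c A)) (l (c A) A) = pr (e (c B)) (l (c B) B)" for A B
    proof -
      have A: "A \<subseteq> K" "A \<prec> N" using AB by (auto intro: lesspoll_trans1[OF subset_imp_lepoll])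
      have "e (c A) = e (c B)" "l (c A) A = l (c B) B"
        using pr_inj[OF eT[OF A(2)] lT[OF A] eT[OF AB(3)] lT[OF AB(2,3)] AB(4)] by blast+
      moreover have "c A = c B" using calculation(1) inj_onD[OF e(1)] c[OF A(2)] c[OF AB(3)] by blast
      ultimately show ?thesis using l' c[OF AB(3)] AB(1,2) eqpoll_imp_lepoll by metis
    qed
  qed
qed

subsection \<open>Discrete subspaces\<close>

definition discrete_in :: "'a topology \<Rightarrow> 'a set \<Rightarrow> bool" where
  "discrete_in X D \<longleftrightarrow> (\<forall>x\<in>D. \<exists>U. openin X U \<and> U \<inter> D = {x})"

lemma discrete_in_subset:
  assumes "discrete_in X D" "E \<subseteq> D"
  shows "discrete_in X E"
  unfolding discrete_in_def
proof
  fix x assume x: "x \<in> E"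
  then obtain U where "openin X U" "U \<inter> D = {x}" using assms unfolding discrete_in_def by blast
  then show "\<exists>U. openin X U \<and> U \<inter> E = {x}" using x assms(2) by (intro exI[of _ U]) blast
qed

lemma discrete_in_closure:
  assumes "discrete_in X D" "E \<subseteq> D" "x \<in> D" "x \<in> X closure_of E"
  shows "x \<in> E"
proof -
  obtain U where U: "openin X U" "U \<inter> D = {x}" using assms unfolding discrete_in_def by blast
  then obtain y where "y \<in> U" "y \<in> E" using assms(4) unfolding in_closure_of by blast
  moreover have "y = x" using calculation U(2) assms(2) by auto
  ultimately show ?thesis by simp
qed

lemma regular_space_closure:
  assumes "regular_space X" "openin X W" "x \<in> W"
  obtains U where "openin X U" "x \<in> U" "X closure_of U \<subseteq> W"
proof -
  have "\<exists>U V. openin X U \<and> closedin X V \<and> x \<in> U \<and> U \<subseteq> V \<and> V \<subseteq> W"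
    using assms neighbourhood_base_of_closedin[of X] unfolding neighbourhood_base_of by blast
  then obtain U V where "openin X U" "closedin X V" "x \<in> U" "U \<subseteq> V" "V \<subseteq> W" by blast
  then show thesis using that[of U] closure_of_minimal[of U V X] by blast
qed

text \<open>Going up the well-order, keep a point if it is not in the closure of the points kept so
  far. Removing this closure from a neighbourhood that misses all later points isolates a kept point
  among the kept ones.\<close>

lemma right_separated_discrete:
  assumes R: "strict_wo R Y" and Y: "Y \<subseteq> topspace X"
    and sep: "\<And>y. y \<in> Y \<Longrightarrow> \<exists>U. openin X U \<and> y \<in> U \<and> (\<forall>z\<in>Y. (y, z) \<in> R \<longrightarrow> z \<notin> U)"
  obtains D where "D \<subseteq> Y" "discrete_in X D" "Y \<subseteq> X closure_of D"
proof -
  define H where "H d y = (y \<notin> X closure_of {z\<in>Y. (z, y) \<in> R \<and> d z})" for d y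
  define d where "d = wfrec R H"
  have d: "d y \<longleftrightarrow> y \<notin> X closure_of {z\<in>Y. (z, y) \<in> R \<and> d z}" for y
  proof -
    have "d y = H (cut d R y) y" unfolding d_def by (rule wfrec[OF strict_woD(1)[OF R]])
    moreover have "{z\<in>Y. (z, y) \<in> R \<and> cut d R y z} = {z\<in>Y. (z, y) \<in> R \<and> d z}"
      by (auto simp: cut_apply)
    ultimately show ?thesis by (simp add: H_def)
  qed
  define D where "D = {y\<in>Y. d y}"
  show thesis
  proof
    show "D \<subseteq> Y" by (auto simp: D_def)
    show "discrete_in X D" unfolding discrete_in_def
    proof
      fix y assume y: "y \<in> D"
      then have yY: "y \<in> Y" and dy: "d y" by (auto simp: D_def)
      let ?E = "{z\<in>Y. (z, y) \<in> R \<and> d z}"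
      obtain U where U: "openin X U" "y \<in> U" "\<And>z. z \<in> Y \<Longrightarrow> (y, z) \<in> R \<Longrightarrow> z \<notin> U"
        using sep[OF yY] by blast
      have op: "openin X (U - X closure_of ?E)" using U(1) by (simp add: openin_diff)
      have yc: "y \<notin> X closure_of ?E" using d dy by blast
      have "?E \<subseteq> X closure_of ?E" using Y by (intro closure_of_subset) auto
      then have "z = y" if "z \<in> D" "z \<in> U - X closure_of ?E" for z
        using that U(3)[of z] strict_woD(3)[OF R, of z y] yY unfolding D_def by blast
      then have "(U - X closure_of ?E) \<inter> D = {y}" using y yc U(2) by blast
      then show "\<exists>U. openin X U \<and> U \<inter> D = {y}" using op by blast
    qed
    show "Y \<subseteq> X closure_of D"
    proof
      fix y assume y: "y \<in> Y"
      show "y \<in> X closure_of D"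
      proof (cases "d y")
        case True
        then have "y \<in> D" using y by (simp add: D_def)
        moreover have "D \<subseteq> X closure_of D" using Y by (intro closure_of_subset) (auto simp: D_def)
        ultimately show ?thesis by blast
      next
        case False
        then have "y \<in> X closure_of {z\<in>Y. (z, y) \<in> R \<and> d z}" using d by blast
        moreover have "{z\<in>Y. (z, y) \<in> R \<and> d z} \<subseteq> D" by (auto simp: D_def)
        ultimately show ?thesis using closure_of_mono by blast
      qed
    qed
  qed
qed

text \<open>By regularity the separating neighbourhoods \<open>U y\<close> can be chosen so that
  even their closures miss the later points. Since \<open>y\<close> is in the closure of
  \<open>U y \<inter> D\<close>, this trace determines \<open>y\<close>.\<close>

lemma right_separated_lepoll:
  assumes reg: "regular_space X" and R: "strict_wo R Y" and Y: "Y \<subseteq> topspace X"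
    and sep: "\<And>y. y \<in> Y \<Longrightarrow> \<exists>U. openin X U \<and> y \<in> U \<and> (\<forall>z\<in>Y. (y, z) \<in> R \<longrightarrow> z \<notin> U)"
  obtains D where "D \<subseteq> Y" "discrete_in X D" "Y \<lesssim> Pow D"
proof -
  obtain D where D: "D \<subseteq> Y" "discrete_in X D" "Y \<subseteq> X closure_of D"
    by (rule right_separated_discrete[OF R Y sep])
  have "\<exists>U. openin X U \<and> y \<in> U \<and> (\<forall>z\<in>Y. (y, z) \<in> R \<longrightarrow> z \<notin> X closure_of U)" if "y \<in> Y" for y
  proof -
    obtain W where W: "openin X W" "y \<in> W" "\<forall>z\<in>Y. (y, z) \<in> R \<longrightarrow> z \<notin> W" using sep[OF \<open>y \<in> Y\<close>] by blast
    obtain U where "openin X U" "y \<in> U" "X closure_of U \<subseteq> W" by (rule regular_space_closure[OF reg W(1,2)])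
    then show ?thesis using W(3) by blast
  qed
  then have "\<forall>y\<in>Y. \<exists>U. openin X U \<and> y \<in> U \<and> (\<forall>z\<in>Y. (y, z) \<in> R \<longrightarrow> z \<notin> X closure_of U)" by blast
  from bchoice[OF this] obtain U where
    U: "\<forall>y\<in>Y. openin X (U y) \<and> y \<in> U y \<and> (\<forall>z\<in>Y. (y, z) \<in> R \<longrightarrow> z \<notin> X closure_of (U y))" ..
  have cl: "y \<in> X closure_of (U y \<inter> D)" if "y \<in> Y" for y
  proof -
    have "y \<in> U y \<inter> X closure_of D" using that U D(3) by blast
    then show ?thesis using openin_Int_closure_of_subset[of X "U y" D] U that by blast
  qed
  have "\<not> (y, z) \<in> R" if "y \<in> Y" "z \<in> Y" "U y \<inter> D = U z \<inter> D" for y z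
  proof
    assume "(y, z) \<in> R"
    then have "z \<notin> X closure_of (U y)" using U that by blast
    moreover have "z \<in> X closure_of (U y \<inter> D)" using cl[OF that(2)] that(3) by simp
    moreover have "X closure_of (U y \<inter> D) \<subseteq> X closure_of (U y)" by (intro closure_of_mono) auto
    ultimately show False by blast
  qed
  then have "inj_on (\<lambda>y. U y \<inter> D) Y" using strict_woD(3)[OF R] unfolding inj_on_def by metis
  moreover have "(\<lambda>y. U y \<inter> D) ` Y \<subseteq> Pow D" by blast
  ultimately have "Y \<lesssim> Pow D" unfolding lepoll_def by blast
  then show thesis using that[OF D(1,2)] by blast
qed

lemma discrete_in_lesspoll:
  assumes "\<not> (\<exists>D\<subseteq>G. discrete_in X D \<and> D \<approx> N)" "discrete_in X D" "D \<subseteq> G"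
  shows "D \<prec> N"
proof -
  have "\<not> N \<lesssim> D"
  proof
    assume "N \<lesssim> D"
    then obtain E where "E \<subseteq> D" "E \<approx> N" using exists_subset_eqpoll by blast
    then show False using assms discrete_in_subset[OF assms(2)] by blast
  qed
  then show ?thesis by (simp add: not_lepoll)
qed

text \<open>Taking the least index makes the cover disjoint: all points of \<open>G j\<close> have
  index at most \<open>j\<close>. Hence a set on which the index is injective is right-separated by
  open \<open>G j\<close>.\<close>

definition cover_index :: "'i set \<Rightarrow> ('i \<Rightarrow> 'a set) \<Rightarrow> 'a \<Rightarrow> 'i" where
  "cover_index I G p = (SOME i. i \<in> I \<and> p \<in> G i \<and> (\<forall>j\<in>I. p \<in> G j \<longrightarrow> j = i \<or> (i, j) \<in> card_less I))"

lemma cover_index: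
  assumes "p \<in> (\<Union>i\<in>I. G i)"
  shows "cover_index I G p \<in> I" "p \<in> G (cover_index I G p)"
    "\<And>j. j \<in> I \<Longrightarrow> p \<in> G j \<Longrightarrow> j = cover_index I G p \<or> (cover_index I G p, j) \<in> card_less I"
proof -
  obtain i where "i \<in> {i\<in>I. p \<in> G i}" "\<And>j. j \<in> {i\<in>I. p \<in> G i} \<Longrightarrow> j = i \<or> (i, j) \<in> card_less I"
    by (rule strict_wo_least[OF strict_wo_card_less, of "{i\<in>I. p \<in> G i}"]) (use assms in auto)
  then have "\<exists>i. i \<in> I \<and> p \<in> G i \<and> (\<forall>j\<in>I. p \<in> G j \<longrightarrow> j = i \<or> (i, j) \<in> card_less I)" by blast
  then have "cover_index I G p \<in> I \<and> p \<in> G (cover_index I G p) \<and>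
    (\<forall>j\<in>I. p \<in> G j \<longrightarrow> j = cover_index I G p \<or> (cover_index I G p, j) \<in> card_less I)"
    unfolding cover_index_def by (rule someI_ex)
  then show "cover_index I G p \<in> I" "p \<in> G (cover_index I G p)"
    "\<And>j. j \<in> I \<Longrightarrow> p \<in> G j \<Longrightarrow> j = cover_index I G p \<or> (cover_index I G p, j) \<in> card_less I"
    by simp_all
qed

text \<open>
  Enumerating the pieces of a well-ordered cover by small open sets splits \<open>P\<close> into \<open>|T|\<close> right-separated
  sets \<open>Y t\<close>, each in the closure of a discrete \<open>D t \<subseteq> Y t\<close>.  Labelling a neighbourhood by its trace on
  \<open>D t\<close> makes these traces constant along a chain, and then all centres lie in the closure of this
  trace, which has at most \<open>|T|\<close> points.
\<close>

lemma noetherian_on_small_spread: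
  fixes N :: "'n set" and T :: "'t set"
  assumes X: "t1_space X" "regular_space X" and P: "P \<subseteq> topspace X"
    and T: "infinite T" "N \<lesssim> T" and N: "\<And>x. x \<in> N \<Longrightarrow> Pow {y. (y, x) \<in> card_less N} \<lesssim> T"
    and big: "\<And>p U. p \<in> P \<Longrightarrow> openin X U \<Longrightarrow> p \<in> U \<Longrightarrow> T \<lesssim> U"
    and loc: "\<And>p. p \<in> P \<Longrightarrow> \<exists>G. openin X G \<and> p \<in> G \<and> G \<lesssim> T \<and> \<not> (\<exists>D\<subseteq>G. discrete_in X D \<and> D \<approx> N)"
  shows "noetherian_on X P"
proof -
  \<comment> \<open>The closure must be small too, since the centres will be located in the closure
    of a discrete trace and not in the trace itself.\<close>
  have "\<exists>G. openin X G \<and> p \<in> G \<and> X closure_of G \<lesssim> T \<and> (\<forall>D\<subseteq>G. discrete_in X D \<longrightarrow> D \<prec> N)"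
    if p: "p \<in> P" for p
  proof -
    obtain G0 where G0: "openin X G0" "p \<in> G0" "G0 \<lesssim> T" "\<not> (\<exists>D\<subseteq>G0. discrete_in X D \<and> D \<approx> N)"
      using loc[OF p] by blast
    obtain G where G: "openin X G" "p \<in> G" "X closure_of G \<subseteq> G0" by (rule regular_space_closure[OF X(2) G0(1,2)])
    have "G \<subseteq> X closure_of G" using G(1) by (simp add: closure_of_subset openin_subset)
    then have sub: "G \<subseteq> G0" using G(3) by blast
    have "X closure_of G \<lesssim> T" by (rule lepoll_trans[OF subset_imp_lepoll[OF G(3)] G0(3)])
    moreover have "D \<prec> N" if "D \<subseteq> G" "discrete_in X D" for D
      using discrete_in_lesspoll[OF G0(4) that(2)] that(1) sub by blast
    ultimately show ?thesis using G(1,2) by blast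
  qed
  then have "\<forall>p\<in>P. \<exists>G. openin X G \<and> p \<in> G \<and> X closure_of G \<lesssim> T \<and> (\<forall>D\<subseteq>G. discrete_in X D \<longrightarrow> D \<prec> N)" by blast
  from bchoice[OF this] obtain G where
    G': "\<forall>p\<in>P. openin X (G p) \<and> p \<in> G p \<and> X closure_of (G p) \<lesssim> T \<and> (\<forall>D\<subseteq>G p. discrete_in X D \<longrightarrow> D \<prec> N)" ..
  have G: "openin X (G p)" "p \<in> G p" "X closure_of (G p) \<lesssim> T" "\<And>D. D \<subseteq> G p \<Longrightarrow> discrete_in X D \<Longrightarrow> D \<prec> N"
    if "p \<in> P" for p using G' that by blast+
  have GT: "G p \<lesssim> T" if p: "p \<in> P" for p
    by (rule lepoll_trans[OF subset_imp_lepoll G(3)[OF p]]) (simp add: G(1)[OF p] closure_of_subset openin_subset)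
  define i where "i = cover_index P G"
  have i: "i p \<in> P" "p \<in> G (i p)" "\<And>j. j \<in> P \<Longrightarrow> p \<in> G j \<Longrightarrow> j = i p \<or> (i p, j) \<in> card_less P"
    if "p \<in> P" for p using cover_index[of p G P] G(2) that unfolding i_def by blast+
  have "\<forall>S :: 'a set. \<exists>e. S \<lesssim> T \<longrightarrow> inj_on e S \<and> e ` S \<subseteq> T" unfolding lepoll_def by blast
  from choice[OF this] obtain e where e': "\<forall>S :: 'a set. S \<lesssim> T \<longrightarrow> inj_on (e S) S \<and> e S ` S \<subseteq> T" ..
  then have e: "inj_on (e S) S \<and> e S ` S \<subseteq> T" if "S \<lesssim> T" for S using that by blast
  \<comment> \<open>The number of \<open>p\<close> within its piece. Points with the same number lie
    in different pieces, so \<open>i\<close> is injective on \<open>Y t\<close>.\<close>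
  define a where "a p = e (G (i p)) p" for p
  have aT: "a p \<in> T" if "p \<in> P" for p
    using e[OF GT[OF i(1)[OF that]]] i(2)[OF that] unfolding a_def by blast
  define Y where "Y t = {p\<in>P. a p = t}" for t
  have YP: "Y t \<subseteq> P" for t by (auto simp: Y_def)
  have i_inj: "inj_on i (Y t)" for t
  proof (rule inj_onI)
    fix p q assume pq: "p \<in> Y t" "q \<in> Y t" "i p = i q"
    then have P': "p \<in> P" "q \<in> P" "a p = a q" by (auto simp: Y_def)
    then have "e (G (i p)) p = e (G (i p)) q" using pq(3) by (simp add: a_def)
    then show "p = q" using e[OF GT[OF i(1)[OF P'(1)]]] i(2)[OF P'(1)] i(2)[OF P'(2)] pq(3) by (metis inj_onD)
  qed
  have "\<exists>D. D \<subseteq> Y t \<and> discrete_in X D \<and> Y t \<subseteq> X closure_of D" for t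
  proof (rule right_separated_discrete[of "inv_image (card_less P) i" "Y t" X])
    show "strict_wo (inv_image (card_less P) i) (Y t)"
      by (rule strict_wo_inv_image[OF strict_wo_card_less _ i_inj]) (use YP i(1) in auto)
    show "Y t \<subseteq> topspace X" using YP P by blast
    show "\<exists>U. openin X U \<and> y \<in> U \<and> (\<forall>z\<in>Y t. (y, z) \<in> inv_image (card_less P) i \<longrightarrow> z \<notin> U)"
      if y: "y \<in> Y t" for y
    proof (intro exI conjI ballI impI)
      have yP: "y \<in> P" using y YP by blast
      show "openin X (G (i y))" "y \<in> G (i y)" using i[OF yP] G(1) by blast+
      fix z assume z: "z \<in> Y t" "(y, z) \<in> inv_image (card_less P) i"
      show "z \<notin> G (i y)"
      proof
        assume "z \<in> G (i y)"
        then have "i y = i z \<or> (i z, i y) \<in> card_less P" using i(3)[of z "i y"] z(1) YP i(1)[OF yP] by blast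
        moreover have "(i y, i z) \<in> card_less P" using z(2) by simp
        ultimately show False using strict_woD(4,5)[OF strict_wo_card_less] by metis
      qed
    qed
  qed blast
  then have "\<forall>t. \<exists>D. D \<subseteq> Y t \<and> discrete_in X D \<and> Y t \<subseteq> X closure_of D" by blast
  from choice[OF this] obtain D where D': "\<forall>t. D t \<subseteq> Y t \<and> discrete_in X (D t) \<and> Y t \<subseteq> X closure_of (D t)" ..
  have D: "D t \<subseteq> Y t" "discrete_in X (D t)" "Y t \<subseteq> X closure_of (D t)" for t using D' by blast+
  have "\<exists>l :: 'a set \<Rightarrow> 't. (\<forall>A. A \<subseteq> P \<and> A \<prec> N \<longrightarrow> l A \<in> T) \<and>
    (\<forall>A B. A \<subseteq> B \<and> B \<subseteq> P \<and> B \<prec> N \<and> l A = l B \<longrightarrow> A = B)"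
    by (rule proper_labelling_lesspoll[OF T N, of P]) blast+
  then obtain l :: "'a set \<Rightarrow> 't" where l': "(\<forall>A. A \<subseteq> P \<and> A \<prec> N \<longrightarrow> l A \<in> T) \<and>
    (\<forall>A B. A \<subseteq> B \<and> B \<subseteq> P \<and> B \<prec> N \<and> l A = l B \<longrightarrow> A = B)" ..
  have l: "l A \<in> T" if "A \<subseteq> P" "A \<prec> N" for A using l' that by blast
  have l_inj: "A = B" if "A \<subseteq> B" "B \<subseteq> P" "B \<prec> N" "l A = l B" for A B using l' that by blast
  obtain pr where pr: "\<And>a b. a \<in> T \<Longrightarrow> b \<in> T \<Longrightarrow> pr a b \<in> T"
    and pr_inj: "\<And>a b c d. a \<in> T \<Longrightarrow> b \<in> T \<Longrightarrow> c \<in> T \<Longrightarrow> d \<in> T \<Longrightarrow> pr a b = pr c d \<Longrightarrow> a = c \<and> b = d"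
    using pairing_ex[OF T(1)] by metis
  define A where "A p U = (U \<inter> G p) \<inter> D (a p)" for p U
  have AP: "A p U \<subseteq> P" for p U using D(1) YP by (auto simp: A_def)
  have AN: "A p U \<prec> N" if "p \<in> P" for p U
  proof (rule G(4)[OF that])
    show "A p U \<subseteq> G p" by (auto simp: A_def)
    show "discrete_in X (A p U)" by (rule discrete_in_subset[OF D(2)[of "a p"]]) (auto simp: A_def)
  qed
  have clA: "X closure_of A p U \<lesssim> T" if "p \<in> P" for p U
    by (rule lepoll_trans[OF subset_imp_lepoll[OF closure_of_mono] G(3)[OF that]]) (auto simp: A_def)
  have pA: "p \<in> X closure_of A p U" if p: "p \<in> P" "openin X U" "p \<in> U" for p U
  proof -
    have "p \<in> (U \<inter> G p) \<inter> X closure_of (D (a p))" using D(3)[of "a p"] p G(2) by (auto simp: Y_def)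
    then show ?thesis
      using openin_Int_closure_of_subset[of X "U \<inter> G p" "D (a p)"] p(2) G(1)[OF p(1)] unfolding A_def
      by (simp add: openin_Int subset_iff)
  qed
  \<comment> \<open>The position of the centre in the closure of its trace: it separates different
    centres that have the same trace.\<close>
  define ix where "ix p U = e (X closure_of A p U) p" for p U
  have ixT: "ix p U \<in> T" if "p \<in> P" "openin X U" "p \<in> U" for p U
    using e[OF clA[OF that(1)]] pA[OF that] unfolding ix_def by blast
  show ?thesis
  proof (rule noetherian_on_by_labels[OF X(1) P T(1) big, where W="\<lambda>p U. U \<inter> G p" and
      lab="\<lambda>p U. pr (a p) (pr (l (A p U)) (ix p U))"])
    show "selector X P (\<lambda>p U. U \<inter> G p)" unfolding selector_def using G(1,2) by (simp add: openin_Int)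
    show "pr (a p) (pr (l (A p U)) (ix p U)) \<in> T" if "p \<in> P" "openin X U" "p \<in> U" for p U
      using pr aT l[OF AP AN] ixT that by simp
    fix p U s
    assume sq: "nbhd_seq X P p U" "incseq (\<lambda>n. U n \<inter> G (p n))"
      "\<And>n. pr (a (p n)) (pr (l (A (p n) (U n))) (ix (p n) (U n))) = s"
    note pP = nbhd_seqD(2)[OF sq(1)]
    note ix = ixT[OF pP nbhd_seqD(3,4)[OF sq(1)]]
    have eqs: "a (p m) = a (p n) \<and> l (A (p m) (U m)) = l (A (p n) (U n)) \<and> ix (p m) (U m) = ix (p n) (U n)" for m n
    proof -
      have *: "a (p m) = a (p n) \<and> pr (l (A (p m) (U m))) (ix (p m) (U m)) = pr (l (A (p n) (U n))) (ix (p n) (U n))"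
        by (rule pr_inj[OF aT[OF pP] pr[OF l[OF AP AN[OF pP]] ix] aT[OF pP] pr[OF l[OF AP AN[OF pP]] ix]]) (simp add: sq(3))
      moreover have "l (A (p m) (U m)) = l (A (p n) (U n)) \<and> ix (p m) (U m) = ix (p n) (U n)"
        by (rule pr_inj[OF l[OF AP AN[OF pP]] ix l[OF AP AN[OF pP]] ix]) (simp add: *)
      ultimately show ?thesis by blast
    qed
    \<comment> \<open>Equal values of \<open>a\<close> mean that both traces are taken on the same
      discrete set, so they inherit the inclusion; equal values of \<open>l\<close> then make them
      equal.\<close>
    have "A (p 0) (U 0) \<subseteq> A (p 1) (U 1)"
      using sq(2) eqs[of 0 1] unfolding A_def incseq_def by (metis Int_mono order_refl zero_le_one)
    then have "A (p 0) (U 0) = A (p 1) (U 1)" using l_inj[OF _ AP AN[OF pP]] eqs by blast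
    then have "e (X closure_of A (p 0) (U 0)) (p 0) = e (X closure_of A (p 0) (U 0)) (p 1)"
      "p 1 \<in> X closure_of A (p 0) (U 0)"
      using eqs[of 0 1] pA[OF pP nbhd_seqD(3,4)[OF sq(1)], of 1] by (simp_all add: ix_def)
    then have "p 0 = p 1"
      using e[OF clA[OF pP]] pA[OF pP nbhd_seqD(3,4)[OF sq(1)], of 0] by (metis inj_onD)
    then show False using nbhd_seqD(1)[OF sq(1)] by (simp add: inj_eq)
  qed
qed

section \<open>Independent families, colourings, and labels from large discrete sets\<close>

text \<open>Points of \<open>D\<close> stand for pairs of a finite subset of \<open>N\<close> and a
  subset of it, and \<open>E t\<close> consists of the pairs \<open>(a, t \<inter> a)\<close>. Given
  finitely many sets other than \<open>t\<close>, let \<open>a\<close> contain a point of difference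
  for each of them: the pair of \<open>t\<close> at \<open>a\<close> lies in none of their
  \<open>E s\<close>.\<close>

lemma independent_family:
  assumes N: "infinite N" and D: "N \<lesssim> D"
  shows "\<exists>E. (\<forall>t. t \<subseteq> N \<longrightarrow> E t \<subseteq> D) \<and>
    (\<forall>t S. t \<subseteq> N \<and> finite S \<and> S \<subseteq> Pow N \<and> E t \<subseteq> (\<Union>s\<in>S. E s) \<longrightarrow> t \<in> S)"
proof -
  have "Fpow N \<times> Fpow N \<lesssim> N \<times> N" by (intro times_lepoll_mono Fpow_lepoll[OF N])
  also have "N \<times> N \<lesssim> N" by (rule times_self_lepoll[OF N])
  also have "N \<lesssim> D" by fact
  finally obtain f where f: "inj_on f (Fpow N \<times> Fpow N)" "f ` (Fpow N \<times> Fpow N) \<subseteq> D" unfolding lepoll_def by blast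
  define E where "E t = (\<lambda>a. f (a, t \<inter> a)) ` Fpow N" for t
  have pair: "(a, t \<inter> a) \<in> Fpow N \<times> Fpow N" if "a \<in> Fpow N" for a t
    using that by (auto simp: Fpow_def)
  show ?thesis
  proof (intro exI[of _ E] conjI allI impI)
    show "E t \<subseteq> D" for t using f(2) pair unfolding E_def by blast
    fix t S assume "t \<subseteq> N \<and> finite S \<and> S \<subseteq> Pow N \<and> E t \<subseteq> (\<Union>s\<in>S. E s)"
    then have S: "t \<subseteq> N" "finite S" "S \<subseteq> Pow N" "E t \<subseteq> (\<Union>s\<in>S. E s)" by simp_all
    show "t \<in> S"
    proof (rule ccontr)
      assume "t \<notin> S"
      have "\<forall>s\<in>S. \<exists>x. x \<in> N \<and> (x \<in> t) \<noteq> (x \<in> s)"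
      proof
        fix s assume s: "s \<in> S"
        then have "s \<noteq> t" using \<open>t \<notin> S\<close> by blast
        then obtain x where "(x \<in> t) \<noteq> (x \<in> s)" by (auto simp: set_eq_iff)
        then show "\<exists>x. x \<in> N \<and> (x \<in> t) \<noteq> (x \<in> s)" using S(1,3) s by auto
      qed
      from bchoice[OF this] obtain x where x: "\<forall>s\<in>S. x s \<in> N \<and> (x s \<in> t) \<noteq> (x s \<in> s)" ..
      define a where "a = x ` S"
      have a: "a \<in> Fpow N" using x S(2) by (auto simp: a_def Fpow_def)
      then have "f (a, t \<inter> a) \<in> E t" by (auto simp: E_def)
      then obtain s b where s: "s \<in> S" "b \<in> Fpow N" "f (a, t \<inter> a) = f (b, s \<inter> b)"
        using S(4) unfolding E_def by blast
      then have "(a, t \<inter> a) = (b, s \<inter> b)" using inj_onD[OF f(1)] pair a by blast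
      then have "t \<inter> a = s \<inter> a" by auto
      moreover have "x s \<in> a" using s(1) by (simp add: a_def)
      ultimately show False using x s(1) by blast
    qed
  qed
qed

text \<open>In a recursion along \<open>R\<close>, fewer than \<open>|M|\<close> colours are
  forbidden at each point.\<close>

lemma greedy_colouring:
  assumes R: "wf R" and B: "\<And>x. B x \<subseteq> {y. (y, x) \<in> R}" and M: "\<And>x. B x \<prec> M"
  shows "\<exists>c. (\<forall>x. c x \<in> M) \<and> (\<forall>x y. y \<in> B x \<longrightarrow> c y \<noteq> c x)"
proof -
  define H where "H c x = (SOME m. m \<in> M \<and> m \<notin> c ` B x)" for c x
  define c where "c = wfrec R H"
  have c: "c x \<in> M \<and> c x \<notin> c ` B x" for x
  proof -
    have "c x = H (cut c R x) x" unfolding c_def by (rule wfrec[OF R])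
    moreover have "cut c R x ` B x = c ` B x"
    proof (rule image_cong[OF refl])
      fix y assume "y \<in> B x"
      then have "(y, x) \<in> R" using B by blast
      then show "cut c R x y = c y" by (rule cut_apply)
    qed
    ultimately have "c x = (SOME m. m \<in> M \<and> m \<notin> c ` B x)" by (simp add: H_def)
    moreover have "\<exists>m. m \<in> M \<and> m \<notin> c ` B x"
    proof (rule ccontr)
      assume "\<not> ?thesis"
      then have "M \<lesssim> B x" by (intro subset_image_lepoll[of _ c]) blast
      then show False using M[of x] not_lepoll by blast
    qed
    ultimately show ?thesis using someI_ex[of "\<lambda>m. m \<in> M \<and> m \<notin> c ` B x"] by simp
  qed
  show ?thesis using c by (intro exI[of _ c]) (metis imageI)
qed

text \<open>A colour combines a colour of the index \<open>i p\<close> with the number of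
  \<open>p\<close> in \<open>G (i p)\<close>. A point \<open>q\<close> of \<open>G (i p)\<close> has
  index at most \<open>i p\<close>: a smaller index was avoided by the greedy colour, and with equal
  index the numbers decide. Only indices of points in \<open>G x\<close> are avoided at
  \<open>x\<close>, which are fewer than \<open>|M|\<close>.\<close>

lemma local_colouring:
  fixes M :: "'m set" and G :: "'a \<Rightarrow> 'a set"
  assumes M: "infinite M" and G: "\<And>p. p \<in> P \<Longrightarrow> p \<in> G p \<and> G p \<prec> M"
  obtains i :: "'a \<Rightarrow> 'a" and col :: "'a \<Rightarrow> 'm" where
    "\<And>p. p \<in> P \<Longrightarrow> i p \<in> P \<and> p \<in> G (i p) \<and> col p \<in> M"
    "\<And>p q. p \<in> P \<Longrightarrow> q \<in> P \<Longrightarrow> q \<in> G (i p) \<Longrightarrow> col p = col q \<Longrightarrow> p = q"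
proof -
  define i where "i = cover_index P G"
  have i: "i p \<in> P" "p \<in> G (i p)" "\<And>j. j \<in> P \<Longrightarrow> p \<in> G j \<Longrightarrow> j = i p \<or> (i p, j) \<in> card_less P"
    if "p \<in> P" for p using cover_index[of p G P] G that unfolding i_def by blast+
  have "\<forall>x\<in>P. \<exists>e. inj_on e (G x) \<and> e ` G x \<subseteq> M"
    using G lesspoll_imp_lepoll unfolding lepoll_def by metis
  from bchoice[OF this] obtain e where e: "\<forall>x\<in>P. inj_on (e x) (G x) \<and> e x ` G x \<subseteq> M" ..
  define B where "B x = (if x \<in> P then {y. (y, x) \<in> card_less P} \<inter> i ` (G x \<inter> P) else {})" for x
  have BM: "B x \<prec> M" for x
  proof (cases "x \<in> P")
    case True
    have "B x \<lesssim> G x \<inter> P" by (rule subset_image_lepoll[of _ i]) (simp add: B_def)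
    also have "G x \<inter> P \<lesssim> G x" by (rule subset_imp_lepoll) blast
    also have "G x \<prec> M" using G[OF True] by blast
    finally show ?thesis .
  next
    case False
    then show ?thesis using M by (simp add: B_def finite_lesspoll_infinite)
  qed
  have "\<exists>c. (\<forall>x. c x \<in> M) \<and> (\<forall>x y. y \<in> B x \<longrightarrow> c y \<noteq> c x)"
    by (rule greedy_colouring[OF strict_woD(1)[OF strict_wo_card_less[of P]] _ BM]) (auto simp: B_def)
  then obtain c where c': "(\<forall>x. c x \<in> M) \<and> (\<forall>x y. y \<in> B x \<longrightarrow> c y \<noteq> c x)" ..
  then have c: "c x \<in> M" "y \<in> B x \<Longrightarrow> c y \<noteq> c x" for x y by simp_all
  obtain pr where pr: "\<And>a b. a \<in> M \<Longrightarrow> b \<in> M \<Longrightarrow> pr a b \<in> M"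
    and pr_inj: "\<And>a b c d. a \<in> M \<Longrightarrow> b \<in> M \<Longrightarrow> c \<in> M \<Longrightarrow> d \<in> M \<Longrightarrow> pr a b = pr c d \<Longrightarrow> a = c \<and> b = d"
    using pairing_ex[OF M] by metis
  have eM: "e (i p) p \<in> M" if "p \<in> P" for p using e i(1,2)[OF that] by blast
  show thesis
  proof (rule that[of i "\<lambda>p. pr (c (i p)) (e (i p) p)"])
    show "i p \<in> P \<and> p \<in> G (i p) \<and> pr (c (i p)) (e (i p) p) \<in> M" if "p \<in> P" for p
      using i[OF that] pr[OF c(1) eM[OF that]] by blast
    fix p q assume pq: "p \<in> P" "q \<in> P" "q \<in> G (i p)" "pr (c (i p)) (e (i p) p) = pr (c (i q)) (e (i q) q)"
    then have eq: "c (i p) = c (i q)" "e (i p) p = e (i q) q"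
      using pr_inj[OF c(1) eM[OF pq(1)] c(1) eM[OF pq(2)]] by blast+
    have "i p = i q"
    proof (rule ccontr)
      assume "i p \<noteq> i q"
      then have "(i q, i p) \<in> card_less P" using i(3)[OF pq(2) i(1)[OF pq(1)] pq(3)] by blast
      then have "i q \<in> B (i p)" using i(1)[OF pq(1)] pq(2,3) by (auto simp: B_def)
      then show False using c(2) eq(1) by metis
    qed
    then show "p = q" using eq(2) e i(1,2)[OF pq(1)] pq(3) by (metis inj_onD)
  qed
qed

text \<open>The box consists of closures of independent subsets of \<open>D b\<close>. Discreteness
  recovers each subset from its closure, and the disjoint closures of \<open>D True\<close> and
  \<open>D False\<close> keep the two copies apart, so a finite cover reduces to one within a single
  copy.\<close>

lemma box_from_discrete:
  assumes N: "infinite N" and D: "\<And>b. discrete_in X (D b)" "\<And>b. D b \<subseteq> topspace X" "\<And>b. N \<lesssim> D b"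
    and disj: "X closure_of (D True) \<inter> X closure_of (D False) = {}"
  obtains K where "label_box X (Pow N) K" "\<And>s b. s \<in> Pow N \<Longrightarrow> K s b \<subseteq> X closure_of (D b)"
proof -
  have "\<exists>E. (\<forall>t. t \<subseteq> N \<longrightarrow> E t \<subseteq> D b) \<and>
    (\<forall>t S. t \<subseteq> N \<and> finite S \<and> S \<subseteq> Pow N \<and> E t \<subseteq> (\<Union>s\<in>S. E s) \<longrightarrow> t \<in> S)" for b
    by (rule independent_family[OF N D(3)[of b]])
  then have "\<forall>b. \<exists>E. (\<forall>t. t \<subseteq> N \<longrightarrow> E t \<subseteq> D b) \<and>
    (\<forall>t S. t \<subseteq> N \<and> finite S \<and> S \<subseteq> Pow N \<and> E t \<subseteq> (\<Union>s\<in>S. E s) \<longrightarrow> t \<in> S)" ..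
  from choice[OF this] obtain E where E': "\<forall>b. (\<forall>t. t \<subseteq> N \<longrightarrow> E b t \<subseteq> D b) \<and>
    (\<forall>t S. t \<subseteq> N \<and> finite S \<and> S \<subseteq> Pow N \<and> E b t \<subseteq> (\<Union>s\<in>S. E b s) \<longrightarrow> t \<in> S)" ..
  have E: "E b t \<subseteq> D b" if "t \<subseteq> N" for b t using E' that by blast
  have E_ind: "t \<in> S" if "t \<subseteq> N" "finite S" "S \<subseteq> Pow N" "E b t \<subseteq> (\<Union>s\<in>S. E b s)" for b t S
    using E' that by blast
  define K where "K t b = X closure_of (E b t)" for t b
  have KD: "K t b \<subseteq> X closure_of (D b)" if "t \<subseteq> N" for t b
    unfolding K_def by (rule closure_of_mono[OF E[OF that]])
  show thesis
  proof (rule that[of K])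
    show "label_box X (Pow N) K" unfolding label_box_def
    proof (intro conjI ballI allI impI)
      show "closedin X (K s b)" for s b by (simp add: K_def)
      show "K s True \<inter> K s False = {}" if "s \<in> Pow N" for s
        using KD[of s True] KD[of s False] disj that by blast
      fix s b F
      assume s: "s \<in> Pow N" and F: "finite F \<and> F \<subseteq> Pow N \<times> UNIV \<and> K s b \<subseteq> (\<Union>(t, c)\<in>F. K t c)"
      define S where "S = {t. (t, b) \<in> F}"
      have "S \<subseteq> fst ` F" unfolding S_def by force
      then have fS: "finite S" "S \<subseteq> Pow N" using F finite_subset by (blast, auto simp: S_def)
      have "E b s \<subseteq> (\<Union>t\<in>S. E b t)"
      proof
        fix d assume d: "d \<in> E b s"
        then have dD: "d \<in> D b" using E s by blast
        have Dc: "D b \<subseteq> X closure_of (D b)" by (rule closure_of_subset[OF D(2)])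
        have "E b s \<subseteq> X closure_of (E b s)" using E[of s b] D(2)[of b] s by (intro closure_of_subset) blast
        then have "d \<in> K s b" using d unfolding K_def by blast
        then obtain t c where t: "(t, c) \<in> F" "d \<in> K t c" using F by blast
        then have tN: "t \<subseteq> N" using F by blast
        have "c = b"
        proof (rule ccontr)
          assume "c \<noteq> b"
          then have "X closure_of (D c) \<inter> X closure_of (D b) = {}" using disj by (cases c; cases b) auto
          then show False using KD[OF tN, of c] t(2) dD Dc by blast
        qed
        then have "d \<in> E b t" using discrete_in_closure[OF D(1) E[OF tN] dD] t(2) by (simp add: K_def)
        then show "d \<in> (\<Union>t\<in>S. E b t)" using t(1) \<open>c = b\<close> by (auto simp: S_def)
      qed
      then have "s \<in> S" using E_ind s fS by blast
      then show "(s, b) \<in> F" by (simp add: S_def)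
    qed
    show "K s b \<subseteq> X closure_of (D b)" if "s \<in> Pow N" for s b using KD that by blast
  qed
qed

text \<open>
  Here the subsets of \<open>N\<close> serve as labels of a colouring in which the centre of a neighbourhood has a
  colour different from all other points of the neighbourhood.
\<close>

lemma noetherian_on_large_spread:
  fixes N :: "'n set" and M :: "'m set"
  assumes X: "t1_space X" "regular_space X" and P: "P \<subseteq> topspace X"
    and N: "infinite N" and M: "infinite M" "M \<lesssim> Pow N"
    and disc: "\<And>p U. p \<in> P \<Longrightarrow> openin X U \<Longrightarrow> p \<in> U \<Longrightarrow> \<exists>D\<subseteq>U. discrete_in X D \<and> N \<lesssim> D"
    and loc: "\<And>p. p \<in> P \<Longrightarrow> \<exists>G. openin X G \<and> p \<in> G \<and> G \<prec> M"
  shows "noetherian_on X P"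
proof -
  \<comment> \<open>Points isolated in \<open>P\<close> are split off: any other point has a further
    point \<open>q\<close> of \<open>P\<close> in each neighbourhood, and large discrete sets near
    \<open>q\<close> supply the second copy of the labels.\<close>
  define Q where "Q = {p\<in>P. \<exists>U. openin X U \<and> p \<in> U \<and> U \<inter> P = {p}}"
  have Q: "noetherian_on X Q"
  proof (rule noetherian_on_relatively_discrete)
    fix p assume "p \<in> Q"
    then obtain U where "openin X U" "p \<in> U" "U \<inter> P = {p}" by (auto simp: Q_def)
    then show "\<exists>U. openin X U \<and> p \<in> U \<and> U \<inter> Q = {p}" using \<open>p \<in> Q\<close>
      by (intro exI[of _ U]) (auto simp: Q_def)
  qed
  have "\<forall>p\<in>P. \<exists>G. openin X G \<and> p \<in> G \<and> G \<prec> M" using loc by blast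
  from bchoice[OF this] obtain G where G: "\<forall>p\<in>P. openin X (G p) \<and> p \<in> G p \<and> G p \<prec> M" ..
  then have GM: "p \<in> G p \<and> G p \<prec> M" if "p \<in> P" for p using that by blast
  have "\<exists>i col. (\<forall>p\<in>P. i p \<in> P \<and> p \<in> G (i p) \<and> col p \<in> M) \<and>
    (\<forall>p\<in>P. \<forall>q\<in>P. q \<in> G (i p) \<and> col p = col q \<longrightarrow> p = q)"
    by (rule local_colouring[OF M(1), of P G]) (use GM in blast)+
  then obtain i col where i: "\<forall>p\<in>P. i p \<in> P \<and> p \<in> G (i p) \<and> col p \<in> M"
    and col: "\<forall>p\<in>P. \<forall>q\<in>P. q \<in> G (i p) \<and> col p = col q \<longrightarrow> p = q" by blast
  obtain k where k: "inj_on k M" "k ` M \<subseteq> Pow N" using M(2) unfolding lepoll_def by blast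
  define J where "J = {(p, U). p \<in> P - Q \<and> openin X U \<and> p \<in> U}"
  define W where "W j = snd j \<inter> G (i (fst j))" for j
  have W: "openin X (W j) \<and> fst j \<in> W j \<and> k (col (fst j)) \<in> Pow N" if "j \<in> J" for j
  proof (intro conjI)
    have j: "fst j \<in> P" "openin X (snd j)" "fst j \<in> snd j" using that by (auto simp: J_def)
    then have "i (fst j) \<in> P" "fst j \<in> G (i (fst j))" "col (fst j) \<in> M" using i by simp_all
    then show "openin X (W j)" "fst j \<in> W j" "k (col (fst j)) \<in> Pow N"
      using j G k(2) unfolding W_def by (simp add: openin_Int, simp, blast)
  qed
  have av: "\<exists>K\<in>Collect (label_box X (Pow N)). (\<Union>s\<in>Pow N. \<Union>b. K s b) \<subseteq> W j" if j: "j \<in> J" for j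
  proof -
    obtain p where p: "p = fst j" "p \<in> P" "p \<notin> Q" "openin X (W j)" "p \<in> W j"
      using W[OF j] j by (auto simp: J_def)
    then have "W j \<inter> P \<noteq> {p}" by (auto simp: Q_def)
    then obtain q where q: "q \<in> W j" "q \<in> P" "q \<noteq> p" using p by blast
    \<comment> \<open>The aim is a pair of neighbourhoods of \<open>p\<close> and \<open>q\<close>
      with disjoint closures inside \<open>W j\<close>, each hosting one of the two discrete
      sets.\<close>
    have "openin X (W j - {q})"
      using X(1) p(4) q(2) P by (auto simp: t1_space_closedin_singleton intro!: openin_diff)
    then obtain U where U: "openin X U" "p \<in> U" "X closure_of U \<subseteq> W j - {q}"
      using regular_space_closure[OF X(2), of "W j - {q}" p] p(5) q(3) by blast
    have "openin X (W j - X closure_of U)" using p(4) by (simp add: openin_diff)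
    then obtain V where V: "openin X V" "q \<in> V" "X closure_of V \<subseteq> W j - X closure_of U"
      using regular_space_closure[OF X(2), of "W j - X closure_of U" q] U(3) q(1) by blast
    obtain D1 where D1: "D1 \<subseteq> U" "discrete_in X D1" "N \<lesssim> D1" using disc[OF p(2) U(1,2)] by blast
    obtain D2 where D2: "D2 \<subseteq> V" "discrete_in X D2" "N \<lesssim> D2" using disc[OF q(2) V(1,2)] by blast
    define D where "D b = (if b then D1 else D2)" for b
    have c: "X closure_of D1 \<subseteq> X closure_of U" "X closure_of D2 \<subseteq> X closure_of V"
      using D1 D2 by (simp_all add: closure_of_mono)
    have "\<exists>K. label_box X (Pow N) K \<and> (\<forall>s b. s \<in> Pow N \<longrightarrow> K s b \<subseteq> X closure_of (D b))"
    proof (rule box_from_discrete[OF N, of X D])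
      show "discrete_in X (D b)" "N \<lesssim> D b" for b using D1 D2 by (simp_all add: D_def)
      show "D b \<subseteq> topspace X" for b
        using D1(1) D2(1) openin_subset[OF U(1)] openin_subset[OF V(1)] by (auto simp: D_def)
      show "X closure_of (D True) \<inter> X closure_of (D False) = {}" using c V(3) by (auto simp: D_def)
    qed blast
    then obtain K where K: "label_box X (Pow N) K" "\<And>s b. s \<in> Pow N \<Longrightarrow> K s b \<subseteq> X closure_of (D b)" by blast
    have "X closure_of (D b) \<subseteq> W j" for b using c V(3) U(3) by (cases b) (auto simp: D_def)
    then have "(\<Union>s\<in>Pow N. \<Union>b. K s b) \<subseteq> W j" using K(2) by blast
    then show ?thesis using K(1) by blast
  qed
  have "noetherian_on X (P - Q)"
  proof (rule box_labelling[of J X W fst "\<lambda>j. k (col (fst j))" "Pow N" "Collect (label_box X (Pow N))", OF W _ av])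
    fix S assume S: "\<And>j. j \<in> J \<Longrightarrow> openin X (W j - S j) \<and> fst j \<in> W j - S j"
      "\<And>f. (\<And>n. f n \<in> J) \<Longrightarrow> incseq (\<lambda>n. W (f n) - S (f n)) \<Longrightarrow>
       \<exists>g s S0. strict_mono (g :: nat \<Rightarrow> nat) \<and> (\<forall>n. k (col (fst (f (g n)))) = s \<and> S (f (g n)) = S0)"
    define V where "V p U = W (p, U) - S (p, U)" for p U
    have "selector X (P - Q) V" unfolding selector_def V_def
      using S(1) unfolding J_def W_def by fastforce
    moreover have "\<not> incseq (\<lambda>n. V (p n) (U n))" if s: "nbhd_seq X (P - Q) p U" for p U
    proof
      assume inc: "incseq (\<lambda>n. V (p n) (U n))"
      have J: "(p n, U n) \<in> J" for n using nbhd_seqD[OF s] by (auto simp: J_def)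
      have pP: "p n \<in> P" for n using nbhd_seqD(2)[OF s] by blast
      have "\<exists>g s S0. strict_mono (g :: nat \<Rightarrow> nat) \<and> (\<forall>n. k (col (p (g n))) = s \<and> S (p (g n), U (g n)) = S0)"
        using S(2)[of "\<lambda>n. (p n, U n)"] J inc by (simp add: V_def)
      then obtain g c where g: "strict_mono (g :: nat \<Rightarrow> nat)" "\<And>n. k (col (p (g n))) = c" by blast
      let ?m = "g 0" and ?n = "g 1"
      have mn: "?m < ?n" using g(1) by (simp add: strict_mono_less)
      have "col (p ?n) = col (p ?m)" using g(2) inj_onD[OF k(1)] i pP by metis
      moreover have "p ?m \<in> V (p ?m) (U ?m)" using S(1)[OF J] by (simp add: V_def)
      then have "p ?m \<in> V (p ?n) (U ?n)" using inc mn unfolding incseq_def by (meson less_imp_le subsetD)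
      then have "p ?m \<in> G (i (p ?n))" by (simp add: V_def W_def)
      ultimately have "p ?n = p ?m" using col pP by blast
      then show False using mn nbhd_seqD(1)[OF s] by (simp add: inj_eq)
    qed
    ultimately show "noetherian_on X (P - Q)" unfolding noetherian_on_def by blast
  qed simp_all
  then have "noetherian_on X (Q \<union> (P - Q))" by (rule noetherian_on_Un[OF Q])
  then show ?thesis by (rule noetherian_on_subset) blast
qed

subsection \<open>Induction on the local cardinality\<close>

lemma Un_lesspoll: "infinite M \<Longrightarrow> A \<prec> M \<Longrightarrow> B \<prec> M \<Longrightarrow> A \<union> B \<prec> M"
  unfolding lesspoll_iff_card_of by (rule card_of_Un_ordLess_infinite)

lemma Cinfinite_card_of: "infinite M \<Longrightarrow> Cinfinite |M|"
  by (simp add: cinfinite_def Field_card_of card_of_card_order_on)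

lemma UN_lesspoll_regular:
  assumes "infinite M" "regularCard |M|" "I \<prec> M" "\<And>i. i \<in> I \<Longrightarrow> A i \<prec> M"
  shows "(\<Union>i\<in>I. A i) \<prec> M"
  using card_of_UNION_ordLess_infinite_Field_regularCard[OF assms(2) Cinfinite_card_of[OF assms(1)], of I A]
    assms(3,4) unfolding lesspoll_iff_card_of by blast

text \<open>A set no larger than \<open>C\<close> has an order type below that of
  \<open>|S|\<close>, so it is isomorphic to the segment below a unique element of \<open>S\<close>,
  its label. Of the isomorphism between sets with equal labels only strict monotonicity is
  recorded.\<close>

lemma order_type_labelling:
  fixes S :: "'s set" and M :: "'m set" and C :: "'c set"
  assumes C: "C \<prec> S"
  shows "\<exists>t :: 'm set \<Rightarrow> 's. (\<forall>L. L \<subseteq> M \<and> L \<lesssim> C \<longrightarrow> t L \<in> S) \<and>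
    (\<forall>L L'. L \<subseteq> M \<and> L' \<subseteq> M \<and> L \<lesssim> C \<and> L' \<lesssim> C \<and> t L = t L' \<longrightarrow>
      (\<exists>f. f ` L \<subseteq> L' \<and> (\<forall>x\<in>L. \<forall>y\<in>L. (x, y) \<in> card_less M \<longrightarrow> (f x, f y) \<in> card_less M)))"
proof -
  have WM: "Well_order |M|" by (rule card_of_Well_order)
  have F: "Field (Restr |M| L) = L" if "L \<subseteq> M" for L
    using that Refl_Field_Restr2[of "|M|" L] WM by (simp add: Field_card_of order_on_defs)
  have W: "Well_order (Restr |M| L)" for L by (rule Well_order_Restr[OF WM])
  have ex: "\<exists>a. a \<in> S \<and> Restr |M| L =o Restr |S| (underS |S| a)" if L: "L \<subseteq> M" "L \<lesssim> C" for L
  proof -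
    have "Restr |M| L <o |S|"
    proof (rule ccontr)
      assume "\<not> Restr |M| L <o |S|"
      then have "|S| \<le>o Restr |M| L" using not_ordLess_iff_ordLeq[OF card_of_Well_order W] by metis
      then have "|Field |S| | \<le>o |Field (Restr |M| L)|" by (rule card_of_mono2)
      then have "S \<lesssim> L" using F[OF L(1)] by (simp add: Field_card_of lepoll_iff_card_of)
      then have "S \<lesssim> C" using L(2) lepoll_trans by metis
      then show False using C not_lepoll by metis
    qed
    then have "\<exists>a\<in>S. Restr |M| L =o Restr |S| (underS |S| a)"
      by (simp only: ordLess_iff_ordIso_Restr[OF card_of_Well_order W] Field_card_of)
    then show ?thesis by (simp only: Bex_def)
  qed
  define t where "t L = (SOME a. a \<in> S \<and> Restr |M| L =o Restr |S| (underS |S| a))" for L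
  have t: "t L \<in> S \<and> Restr |M| L =o Restr |S| (underS |S| (t L))" if "L \<subseteq> M" "L \<lesssim> C" for L
    using ex[OF that] unfolding t_def by (rule someI_ex)
  show ?thesis
  proof (intro exI[of _ t] conjI allI impI)
    show "t L \<in> S" if "L \<subseteq> M \<and> L \<lesssim> C" for L using t that by blast
    fix L L' assume "L \<subseteq> M \<and> L' \<subseteq> M \<and> L \<lesssim> C \<and> L' \<lesssim> C \<and> t L = t L'"
    then have L: "L \<subseteq> M" "L \<lesssim> C" "L' \<subseteq> M" "L' \<lesssim> C" "t L = t L'" by simp_all
    have "Restr |M| L =o Restr |S| (underS |S| (t L))" using t[OF L(1,2)] by simp
    moreover have "Restr |S| (underS |S| (t L)) =o Restr |M| L'"
      using t[OF L(3,4)] L(5) ordIso_symmetric by metis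
    ultimately have "Restr |M| L =o Restr |M| L'" by (rule ordIso_transitive)
    then obtain f where "iso (Restr |M| L) (Restr |M| L') f" unfolding ordIso_def by blast
    then have f: "bij_betw f L L'" "\<And>x y. x \<in> L \<Longrightarrow> y \<in> L \<Longrightarrow> ((x, y) \<in> Restr |M| L) = ((f x, f y) \<in> Restr |M| L')"
      unfolding iso_iff2 F[OF L(1)] F[OF L(3)] by blast+
    show "\<exists>f. f ` L \<subseteq> L' \<and> (\<forall>x\<in>L. \<forall>y\<in>L. (x, y) \<in> card_less M \<longrightarrow> (f x, f y) \<in> card_less M)"
    proof (intro exI[of _ f] conjI ballI impI)
      show "f ` L \<subseteq> L'" using f(1) by (simp add: bij_betw_def)
      fix x y assume xy: "x \<in> L" "y \<in> L" "(x, y) \<in> card_less M"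
      then have "(f x, f y) \<in> |M|" using f(2)[OF xy(1,2)] by (auto simp: card_less_def)
      moreover have "f x \<noteq> f y" using f(1) xy by (auto simp: bij_betw_def inj_on_def card_less_def)
      ultimately show "(f x, f y) \<in> card_less M" by (simp add: card_less_def)
    qed
  qed
qed

section \<open>Local cardinality and the stages of the induction\<close>

definition locally_less :: "'a topology \<Rightarrow> 'c set \<Rightarrow> 'a set" where
  "locally_less X M = {p\<in>topspace X. \<exists>U. openin X U \<and> p \<in> U \<and> U \<prec> M}"

lemma locally_less_subset: "locally_less X M \<subseteq> topspace X"
  by (auto simp: locally_less_def)

lemma not_locally_less:
  assumes "p \<notin> locally_less X M" "openin X U" "p \<in> U"
  shows "M \<lesssim> U"
proof (rule ccontr)
  assume "\<not> M \<lesssim> U"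
  then have "U \<prec> M" by (simp add: not_lepoll)
  then show False using assms openin_subset[OF assms(2)] by (auto simp: locally_less_def)
qed

text \<open>The base of the induction: neighbourhoods are finite, and in a T1 space their centres
  are isolated points.\<close>

lemma noetherian_on_locally_finite:
  assumes X: "t1_space X" and M: "M \<lesssim> (UNIV :: nat set)"
  shows "noetherian_on X (locally_less X M)"
proof (rule noetherian_on_relatively_discrete)
  fix p assume "p \<in> locally_less X M"
  then obtain U where U: "openin X U" "p \<in> U" "U \<prec> M" "p \<in> topspace X" by (auto simp: locally_less_def)
  have "U \<prec> (UNIV :: nat set)" by (rule lesspoll_trans2[OF U(3) M])
  then have "finite U" using infinite_le_lepoll not_lepoll by metis
  then have "closedin X (U - {p})"
    using X openin_subset[OF U(1)] by (simp add: t1_space_closedin_finite subset_iff)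
  then have "openin X (U - (U - {p}))" using U(1) by (rule openin_diff[rotated])
  moreover have "U - (U - {p}) = {p}" using U(2) by blast
  ultimately have "openin X {p}" by simp
  then show "\<exists>U. openin X U \<and> p \<in> U \<and> U \<inter> locally_less X M = {p}"
    using \<open>p \<in> locally_less X M\<close> by (intro exI[of _ "{p}"]) auto
qed

text \<open>The pieces are indexed by a cofinal set \<open>T\<close> smaller than \<open>M\<close>.
  Points with a neighbourhood smaller than \<open>T\<close> are split off first and fall under
  \<open>IH\<close>; at all others there is room for \<open>T\<close> labels.\<close>

lemma noetherian_on_singular:
  fixes M :: "'c set"
  assumes X: "t1_space X"
    and IH: "\<And>N :: 'c set. N \<prec> M \<Longrightarrow> noetherian_on X (locally_less X N)"
    and M: "(UNIV :: nat set) \<prec> M" "\<not> regularCard |M|"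
  shows "noetherian_on X (locally_less X M)"
proof -
  have iM: "infinite M" using M(1) infinite_le_lepoll lesspoll_imp_lepoll by metis
  obtain K where K: "K \<subseteq> M" "cofinal K |M|" "\<not> |K| =o |M|"
    using M(2) unfolding regularCard_def Field_card_of by metis
  have KM: "K \<prec> M" using subset_imp_lepoll[OF K(1)] K(3) lepoll_iff_leqpoll eqpoll_iff_card_of_ordIso by metis
  obtain C where C: "C \<subseteq> M" "C \<approx> (UNIV :: nat set)" using exists_subset_eqpoll[OF lesspoll_imp_lepoll[OF M(1)]] by blast
  define T where "T = K \<union> C"
  have TM: "T \<prec> M" unfolding T_def by (rule Un_lesspoll[OF iM KM eq_lesspoll_trans[OF C(2) M(1)]])
  have "infinite C" using eqpoll_finite_iff[OF C(2)] by simp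
  then have iT: "infinite T" by (simp add: T_def)
  have T: "T \<subseteq> M" "\<And>x. x \<in> M \<Longrightarrow> \<exists>a\<in>T. (x, a) \<in> card_less M"
    using K(1,2) C(1) unfolding cofinal_card_of T_def by blast+
  let ?F = "\<lambda>x. {y. (y, x) \<in> card_less M}"
  have "\<exists>S \<subseteq> M. ?F t \<prec> S \<and> S \<prec> M" if t: "t \<in> T" for t
  proof -
    have tM: "?F t \<prec> M" by (rule card_less_lesspoll[OF subsetD[OF T(1) t]])
    obtain S where S: "S \<subseteq> M" "?F t \<prec> S" "\<forall>B::nat set. B \<prec> S \<longrightarrow> B \<lesssim> ?F t"
      "infinite (?F t) \<longrightarrow> regularCard |S|" by (rule ex_cardSuc_subset[OF tM, where ?'b = nat])
    \<comment> \<open>The successor of the size of a segment is not that of \<open>M\<close>: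
      infinite successors are regular and \<open>M\<close> is not, and over a finite segment the
      successor is not uncountable.\<close>
    have "\<not> S \<approx> M"
    proof
      assume e: "S \<approx> M"
      have "(UNIV :: nat set) \<prec> S" by (rule lesspoll_eq_trans[OF M(1) eqpoll_sym[OF e]])
      then have "infinite (?F t)" using S(3) infinite_le_lepoll by blast
      moreover have "|S| =o |M|" using e eqpoll_iff_card_of_ordIso by blast
      moreover have "infinite S" using e iM eqpoll_finite_iff by blast
      ultimately have "regularCard |M|" using regularCard_ordIso Cinfinite_card_of S(4) by blast
      then show False using M(2) by blast
    qed
    then have "S \<prec> M" using subset_imp_lepoll[OF S(1)] lepoll_iff_leqpoll by metis
    then show ?thesis using S(1,2) by blast
  qed
  then have "\<forall>t\<in>T. \<exists>S. S \<subseteq> M \<and> ?F t \<prec> S \<and> S \<prec> M" by blast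
  from bchoice[OF this] obtain S where S: "\<forall>t\<in>T. S t \<subseteq> M \<and> ?F t \<prec> S t \<and> S t \<prec> M" ..
  have "noetherian_on X (locally_less X M - locally_less X T)"
  proof (rule noetherian_on_UN[OF X _ iT, where Q="\<lambda>t. locally_less X (S t)"])
    show "locally_less X M - locally_less X T \<subseteq> topspace X" by (auto simp: locally_less_def)
    show "T \<lesssim> U" if "p \<in> locally_less X M - locally_less X T" "openin X U" "p \<in> U" for p U
      using not_locally_less[of p X T U] that by blast
    show "locally_less X M - locally_less X T \<subseteq> (\<Union>t\<in>T. locally_less X (S t))"
    proof
      fix p assume "p \<in> locally_less X M - locally_less X T"
      then obtain U where U: "openin X U" "p \<in> U" "U \<prec> M" "p \<in> topspace X" by (auto simp: locally_less_def)
      obtain x where x: "x \<in> M" "U \<approx> ?F x" by (rule lesspoll_card_less[OF U(3)])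
      obtain t where t: "t \<in> T" "(x, t) \<in> card_less M" using T(2)[OF x(1)] by blast
      have "?F x \<subseteq> ?F t" using t(2) by (auto intro: transD[OF strict_woD(2)[OF strict_wo_card_less]])
      then have "?F x \<lesssim> ?F t" by (rule subset_imp_lepoll)
      then have "U \<lesssim> ?F t" by (rule lepoll_trans1[OF x(2)])
      then have "U \<prec> S t" using S t(1) lesspoll_trans1 by metis
      then show "p \<in> (\<Union>t\<in>T. locally_less X (S t))" using U t(1) by (auto simp: locally_less_def)
    qed
    show "noetherian_on X (locally_less X (S t))" if "t \<in> T" for t using IH S that by blast
  qed
  then have "noetherian_on X (locally_less X T \<union> (locally_less X M - locally_less X T))"
    by (rule noetherian_on_Un[OF IH[OF TM]])
  then show ?thesis by (rule noetherian_on_subset) blast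
qed

text \<open>
  The levels attained in a neighbourhood of \<open>p\<close> have \<open>lev p\<close> as their maximum and, being attained on a
  right-separated set, are few.  Their order type is used as a label.
\<close>

lemma noetherian_on_merge:
  fixes X :: "'a topology" and M :: "'m set" and S :: "'s set" and C :: "'c set" and N :: "'n set"
  assumes X: "t1_space X" "regular_space X" and P: "P \<subseteq> topspace X"
    and S: "infinite S" "C \<prec> S" and N: "\<And>A :: 'a set. A \<prec> N \<Longrightarrow> Pow A \<lesssim> C"
    and big: "\<And>p U. p \<in> P \<Longrightarrow> openin X U \<Longrightarrow> p \<in> U \<Longrightarrow> S \<lesssim> U"
    and lev: "\<And>p. p \<in> P \<Longrightarrow> lev p \<in> M"
    and loc: "\<And>p. p \<in> P \<Longrightarrow> \<exists>G. openin X G \<and> p \<in> G \<and> \<not> (\<exists>D\<subseteq>G. discrete_in X D \<and> D \<approx> N) \<and>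
      (\<forall>q\<in>G \<inter> P. lev q = lev p \<or> (lev q, lev p) \<in> card_less M)"
    and fib: "\<And>x. x \<in> M \<Longrightarrow> noetherian_on X {p\<in>P. lev p = x}"
  shows "noetherian_on X P"
proof -
  let ?R = "card_less M"
  have R: "strict_wo ?R M" by (rule strict_wo_card_less)
  have "\<forall>p\<in>P. \<exists>G. openin X G \<and> p \<in> G \<and> \<not> (\<exists>D\<subseteq>G. discrete_in X D \<and> D \<approx> N) \<and>
      (\<forall>q\<in>G \<inter> P. lev q = lev p \<or> (lev q, lev p) \<in> ?R)" using loc by (intro ballI) simp
  from bchoice[OF this] obtain G where G': "\<forall>p\<in>P. openin X (G p) \<and> p \<in> G p \<and>
      \<not> (\<exists>D\<subseteq>G p. discrete_in X D \<and> D \<approx> N) \<and> (\<forall>q\<in>G p \<inter> P. lev q = lev p \<or> (lev q, lev p) \<in> ?R)" ..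
  have G: "openin X (G p)" "p \<in> G p" "\<not> (\<exists>D\<subseteq>G p. discrete_in X D \<and> D \<approx> N)"
    "\<And>q. q \<in> G p \<Longrightarrow> q \<in> P \<Longrightarrow> lev q = lev p \<or> (lev q, lev p) \<in> ?R" if "p \<in> P" for p
    using bspec[OF G' that] by simp_all
  have "\<forall>x\<in>M. \<exists>V. selector X {p\<in>P. lev p = x} V \<and>
     (\<forall>p U. nbhd_seq X {p\<in>P. lev p = x} p U \<longrightarrow> \<not> incseq (\<lambda>n. V (p n) (U n)))"
    using fib[unfolded noetherian_on_def] by (rule ballI)
  from bchoice[OF this] obtain V where V': "\<forall>x\<in>M. selector X {p\<in>P. lev p = x} (V x) \<and>
     (\<forall>p U. nbhd_seq X {p\<in>P. lev p = x} p U \<longrightarrow> \<not> incseq (\<lambda>n. V x (p n) (U n)))" ..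
  have V: "selector X {p\<in>P. lev p = x} (V x)"
    "\<And>p U. nbhd_seq X {p\<in>P. lev p = x} p U \<Longrightarrow> \<not> incseq (\<lambda>n. V x (p n) (U n))" if "x \<in> M" for x
    using bspec[OF V' that] by simp_all
  define W where "W p U = V (lev p) p (U \<inter> G p)" for p U
  have W: "openin X (W p U) \<and> p \<in> W p U \<and> W p U \<subseteq> U \<inter> G p" if p: "p \<in> P" "openin X U" "p \<in> U" for p U
    using selectorD[OF V(1)[OF lev[OF p(1)]], of p "U \<inter> G p"] p G(1,2)[OF p(1)] unfolding W_def
    by (simp add: openin_Int)
  define L where "L p U = lev ` (W p U \<inter> P)" for p U
  have LM: "L p U \<subseteq> M" for p U using lev by (auto simp: L_def)
  have LC: "L p U \<lesssim> C" if p: "p \<in> P" "openin X U" "p \<in> U" for p U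
  proof -
    have "\<forall>x\<in>L p U. \<exists>y. y \<in> W p U \<inter> P \<and> lev y = x" by (auto simp: L_def)
    from bchoice[OF this] obtain y where y': "\<forall>x\<in>L p U. y x \<in> W p U \<inter> P \<and> lev (y x) = x" ..
    then have y: "y x \<in> W p U \<inter> P \<and> lev (y x) = x" if "x \<in> L p U" for x using that by (rule bspec)
    \<comment> \<open>One point for each attained level. Points of \<open>G z\<close> have level at
      most \<open>lev z\<close>, so \<open>Y\<close> is right-separated, and its discrete subsets
      are smaller than \<open>N\<close> because \<open>Y\<close> lies in \<open>G p\<close>.\<close>
    define Y where "Y = y ` L p U"
    have YP: "Y \<subseteq> P" "Y \<subseteq> W p U" using y by (auto simp: Y_def)
    have inj: "inj_on lev Y" unfolding Y_def using y by (auto simp: inj_on_def)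
    have wo: "strict_wo (inv_image ?R lev) Y"
      by (rule strict_wo_inv_image[OF R _ inj]) (use YP(1) lev in blast)
    have sep: "\<exists>U. openin X U \<and> z \<in> U \<and> (\<forall>z'\<in>Y. (z, z') \<in> inv_image ?R lev \<longrightarrow> z' \<notin> U)" if "z \<in> Y" for z
    proof (intro exI conjI ballI impI)
      have zP: "z \<in> P" using that YP(1) by blast
      show "openin X (G z)" "z \<in> G z" using G(1,2)[OF zP] by simp_all
      fix z' assume z': "z' \<in> Y" "(z, z') \<in> inv_image ?R lev"
      have r: "(lev z, lev z') \<in> ?R" using z'(2) by simp
      show "z' \<notin> G z"
      proof
        assume "z' \<in> G z"
        then have "lev z' = lev z \<or> (lev z', lev z) \<in> ?R" using G(4)[OF zP] z'(1) YP(1) by blast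
        then show False using r strict_woD(4,5)[OF R] by metis
      qed
    qed
    have "Y \<subseteq> topspace X" using YP(1) P by blast
    then obtain D where D: "D \<subseteq> Y" "discrete_in X D" "Y \<lesssim> Pow D"
      by (rule right_separated_lepoll[OF X(2) wo _ sep])
    have "D \<subseteq> G p" using D(1) YP(2) W[OF p] by blast
    then have "D \<prec> N" by (rule discrete_in_lesspoll[OF G(3)[OF p(1)] D(2)])
    have "L p U = lev ` Y" unfolding Y_def using y by (force simp: image_iff)
    then have "L p U \<lesssim> Y" by (simp add: image_lepoll)
    also have "Y \<lesssim> Pow D" by fact
    also have "Pow D \<lesssim> C" by (rule N[OF \<open>D \<prec> N\<close>])
    finally show ?thesis .
  qed
  obtain t :: "'m set \<Rightarrow> 's" where t: "(\<forall>L. L \<subseteq> M \<and> L \<lesssim> C \<longrightarrow> t L \<in> S) \<and>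
    (\<forall>L L'. L \<subseteq> M \<and> L' \<subseteq> M \<and> L \<lesssim> C \<and> L' \<lesssim> C \<and> t L = t L' \<longrightarrow>
      (\<exists>f. f ` L \<subseteq> L' \<and> (\<forall>x\<in>L. \<forall>y\<in>L. (x, y) \<in> ?R \<longrightarrow> (f x, f y) \<in> ?R)))"
    using order_type_labelling[OF S(2), of M] ..
  show ?thesis
  proof (rule noetherian_on_by_labels[OF X(1) P S(1) big, where W=W and lab="\<lambda>p U. t (L p U)"])
    show "selector X P W" unfolding selector_def using W by simp
    show "t (L p U) \<in> S" if "p \<in> P" "openin X U" "p \<in> U" for p U
      using conjunct1[OF t] LM LC[OF that] by simp
    fix p U s assume sq: "nbhd_seq X P p U" "incseq (\<lambda>n. W (p n) (U n))" "\<And>n. t (L (p n) (U n)) = s"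
    note d = nbhd_seqD(2,3,4)[OF sq(1)]
    \<comment> \<open>If the maximal level rose, all earlier levels would lie below the new maximum.
      Equality of the order types would then map the new levels increasingly into the old ones and
      move this maximum down.\<close>
    have lev_const: "lev (p n) = lev (p 0)" for n
    proof (rule ccontr)
      assume ne: "lev (p n) \<noteq> lev (p 0)"
      have "W (p 0) (U 0) \<subseteq> W (p n) (U n)" using sq(2) by (simp add: incseq_def)
      then have LL: "L (p 0) (U 0) \<subseteq> L (p n) (U n)" by (auto simp: L_def)
      have top: "lev (p k) \<in> L (p k) (U k)" for k using W[OF d] d(1) by (auto simp: L_def)
      have max: "x = lev (p k) \<or> (x, lev (p k)) \<in> ?R" if x: "x \<in> L (p k) (U k)" for x k
      proof -
        obtain q where "q \<in> W (p k) (U k)" "q \<in> P" "x = lev q" using x by (auto simp: L_def)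
        then show ?thesis using W[OF d[of k]] G(4)[OF d(1)[of k], of q] by blast
      qed
      have "(lev (p 0), lev (p n)) \<in> ?R" using max[of "lev (p 0)" n] LL top[of 0] ne by auto
      then have less: "(x, lev (p n)) \<in> ?R" if "x \<in> L (p 0) (U 0)" for x
        using max[OF that] transD[OF strict_woD(2)[OF R]] by blast
      obtain f where f: "f ` L (p n) (U n) \<subseteq> L (p 0) (U 0)"
        "\<forall>x\<in>L (p n) (U n). \<forall>y\<in>L (p n) (U n). (x, y) \<in> ?R \<longrightarrow> (f x, f y) \<in> ?R"
        using conjunct2[OF t, rule_format, of "L (p n) (U n)" "L (p 0) (U 0)"] LM LC[OF d] sq(3) by auto
      have "(f (lev (p n)), lev (p n)) \<notin> ?R"
        by (rule strict_wo_no_descent[OF R LM[of "p n" "U n"]]) (use f LL top in auto)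
      moreover have "f (lev (p n)) \<in> L (p 0) (U 0)" using f(1) top by blast
      ultimately show False using less by blast
    qed
    define x where "x = lev (p 0)"
    have xM: "x \<in> M" using lev d(1) by (simp add: x_def)
    have "nbhd_seq X {p\<in>P. lev p = x} p (\<lambda>n. U n \<inter> G (p n))"
      unfolding nbhd_seq_def using nbhd_seqD(1)[OF sq(1)] d G(1,2)[OF d(1)] lev_const
      by (simp add: openin_Int x_def)
    moreover have "W (p n) (U n) = V x (p n) (U n \<inter> G (p n))" for n
      unfolding W_def x_def lev_const[of n] by (rule refl)
    then have "incseq (\<lambda>n. V x (p n) (U n \<inter> G (p n)))" using sq(2) by simp
    ultimately show False using V(2)[OF xM, of p "\<lambda>n. U n \<inter> G (p n)"] by blast
  qed
qed

text \<open>
  With \<open>N\<close> of least cardinality such that \<open>M \<lesssim> Pow N\<close> and \<open>C\<close> bounding \<open>Pow A\<close> for all \<open>A \<prec> N\<close>, the points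
  are split into: those of local cardinality below \<open>C\<close>; those all of whose neighbourhoods contain a
  discrete set of size \<open>|N|\<close> (\<open>H\<close>); and the others, of local cardinality \<open>|C|\<close> (\<open>Q \<inter> locally_less X S\<close>)
  or larger (\<open>Q1\<close>).
\<close>

lemma noetherian_on_regular_limit:
  fixes M :: "'c set"
  assumes X: "t1_space X" "regular_space X"
    and IH: "\<And>N :: 'c set. N \<prec> M \<Longrightarrow> noetherian_on X (locally_less X N)"
    and M: "infinite M" "regularCard |M|" and L: "L \<prec> M" "M \<lesssim> Pow (L :: 'c set)"
  shows "noetherian_on X (locally_less X M)"
proof -
  have "L \<in> {A :: 'c set. M \<lesssim> Pow A}" using L(2) by simp
  then have "\<exists>N\<in>{A :: 'c set. M \<lesssim> Pow A}. \<forall>A. (A, N) \<in> {(A, B). A \<prec> B} \<longrightarrow> A \<notin> {A :: 'c set. M \<lesssim> Pow A}"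
    using wf_lesspoll[unfolded wf_eq_minimal, rule_format, of L "{A. M \<lesssim> Pow A}"] by simp
  then obtain N where N': "N \<in> {A :: 'c set. M \<lesssim> Pow A}"
    "\<forall>A. (A, N) \<in> {(A, B). A \<prec> B} \<longrightarrow> A \<notin> {A :: 'c set. M \<lesssim> Pow A}" ..
  have N: "M \<lesssim> Pow N" "\<And>A :: 'c set. A \<prec> N \<Longrightarrow> \<not> M \<lesssim> Pow A" using N' by simp_all
  have "\<not> L \<prec> N" using N(2) L(2) by blast
  then have "N \<lesssim> L" using not_lepoll by metis
  then have NM: "N \<prec> M" using L(1) by (rule lesspoll_trans1)
  have iN: "infinite N" using infinite_lepoll[OF M(1) N(1)] by simp
  let ?FN = "\<lambda>x. {y. (y, x) \<in> card_less N}"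
  have powN: "Pow (?FN x) \<prec> M" if "x \<in> N" for x
    using N(2)[OF card_less_lesspoll[OF that]] by (simp add: not_lepoll)
  have "\<forall>x\<in>N. \<exists>S. S \<subseteq> M \<and> S \<approx> Pow (?FN x)"
    using exists_subset_eqpoll[OF lesspoll_imp_lepoll[OF powN]] by blast
  from bchoice[OF this] obtain S0 where S0: "\<forall>x\<in>N. S0 x \<subseteq> M \<and> S0 x \<approx> Pow (?FN x)" ..
  \<comment> \<open>A set of the size of \<open>|N|\<close> joined with all 2^\<tau> for \<tau>
    below \<open>|N|\<close>. Minimality of \<open>N\<close> makes each of these powers smaller than
    \<open>M\<close>, and regularity of \<open>|M|\<close> makes their union smaller.\<close>
  define C where "C = N \<union> (\<Union>x\<in>N. S0 x)"
  have "(\<Union>x\<in>N. S0 x) \<prec> M"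
  proof (rule UN_lesspoll_regular[OF M NM])
    show "S0 x \<prec> M" if "x \<in> N" for x using S0 eq_lesspoll_trans[OF _ powN[OF that]] that by blast
  qed
  then have CM: "C \<prec> M" unfolding C_def by (rule Un_lesspoll[OF M(1) NM])
  have NC: "N \<lesssim> C" by (rule subset_imp_lepoll) (auto simp: C_def)
  have powC: "Pow (?FN x) \<lesssim> C" if "x \<in> N" for x
  proof -
    have "S0 x \<subseteq> C" using that by (auto simp: C_def)
    then have "S0 x \<lesssim> C" by (rule subset_imp_lepoll)
    moreover have "Pow (?FN x) \<approx> S0 x" using S0 that eqpoll_sym by blast
    ultimately show ?thesis using lepoll_trans1 by metis
  qed
  have iC: "infinite C" using iN by (simp add: C_def)
  \<comment> \<open>\<open>S\<close> has the successor size of \<open>C\<close>: a neighbourhood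
    smaller than \<open>S\<close> has at most \<open>|C|\<close> points, and \<open>S\<close> offers
    enough labels for the order types of sets no larger than \<open>C\<close>.\<close>
  obtain S where S: "S \<subseteq> M" "C \<prec> S" "\<forall>B :: 'a set. B \<prec> S \<longrightarrow> B \<lesssim> C" "infinite C \<longrightarrow> regularCard |S|"
    by (rule ex_cardSuc_subset[OF CM, where ?'b = 'a])
  have iS: "infinite S" by (rule infinite_lepoll[OF iC lesspoll_imp_lepoll[OF S(2)]])
  define P where "P = locally_less X M"
  have P: "P \<subseteq> topspace X" unfolding P_def by (rule locally_less_subset)
  have PM: "\<exists>G. openin X G \<and> p \<in> G \<and> G \<prec> M" if "p \<in> P" for p using that by (auto simp: P_def locally_less_def)
  define H where "H = {p\<in>P. \<forall>U. openin X U \<and> p \<in> U \<longrightarrow> (\<exists>D\<subseteq>U. discrete_in X D \<and> D \<approx> N)}"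
  have H: "noetherian_on X H"
  proof (rule noetherian_on_large_spread[OF X _ iN M(1) N(1)])
    show "H \<subseteq> topspace X" using P by (auto simp: H_def)
    show "\<exists>D\<subseteq>U. discrete_in X D \<and> N \<lesssim> D" if H': "p \<in> H" "openin X U" "p \<in> U" for p U
    proof -
      obtain D where "D \<subseteq> U" "discrete_in X D" "D \<approx> N" using H' by (auto simp: H_def)
      then show ?thesis using eqpoll_imp_lepoll[OF eqpoll_sym[of D N]] by blast
    qed
    show "\<exists>G. openin X G \<and> p \<in> G \<and> G \<prec> M" if "p \<in> H" for p using PM that by (simp add: H_def)
  qed
  define Q where "Q = P - H - locally_less X C"
  have Qloc: "\<exists>G. openin X G \<and> p \<in> G \<and> \<not> (\<exists>D\<subseteq>G. discrete_in X D \<and> D \<approx> N)" if "p \<in> Q" for p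
    using that by (auto simp: Q_def H_def)
  have QP: "Q \<subseteq> P" by (auto simp: Q_def)
  have loc2: "\<exists>G. openin X G \<and> p \<in> G \<and> G \<lesssim> T \<and> \<not> (\<exists>D\<subseteq>G. discrete_in X D \<and> D \<approx> N)"
    if "p \<in> Q" and U: "openin X U" "p \<in> U" "U \<lesssim> T" for p U and T :: "'c set"
  proof -
    obtain G where G: "openin X G" "p \<in> G" "\<not> (\<exists>D\<subseteq>G. discrete_in X D \<and> D \<approx> N)" using Qloc[OF \<open>p \<in> Q\<close>] by blast
    have "U \<inter> G \<lesssim> T" by (rule lepoll_trans[OF subset_imp_lepoll U(3)]) simp
    then show ?thesis using U(1,2) G by (intro exI[of _ "U \<inter> G"]) auto
  qed
  have Q0: "noetherian_on X (Q \<inter> locally_less X S)"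
  proof (rule noetherian_on_small_spread[OF X _ iC NC powC])
    show "Q \<inter> locally_less X S \<subseteq> topspace X" by (auto simp: locally_less_def)
    show "C \<lesssim> U" if "p \<in> Q \<inter> locally_less X S" "openin X U" "p \<in> U" for p U
      using not_locally_less[of p X C U] that by (simp add: Q_def)
    fix p assume p: "p \<in> Q \<inter> locally_less X S"
    then obtain U where "openin X U" "p \<in> U" "U \<prec> S" by (auto simp: locally_less_def)
    then show "\<exists>G. openin X G \<and> p \<in> G \<and> G \<lesssim> C \<and> \<not> (\<exists>D\<subseteq>G. discrete_in X D \<and> D \<approx> N)"
      using loc2[of p U C] S(3) p by blast
  qed
  define Q1 where "Q1 = Q - locally_less X S"
  have Q1Q: "Q1 \<subseteq> Q" by (auto simp: Q1_def)
  have Q1big: "S \<lesssim> U" if "p \<in> Q1" "openin X U" "p \<in> U" for p U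
    using not_locally_less[of p X S U] that by (simp add: Q1_def)
  let ?F = "\<lambda>x. {y. (y, x) \<in> card_less M}"
  \<comment> \<open>\<open>Op x\<close> consists of the points having a neighbourhood of at most
    \<open>|?F x|\<close> points, so the least such \<open>x\<close>, taken as \<open>lev p\<close>
    below, encodes the least size of a neighbourhood of \<open>p\<close>. As \<open>Op x\<close> is
    open, nearby points have no higher level.\<close>
  define Op where "Op x = \<Union>{U. openin X U \<and> U \<lesssim> ?F x}" for x
  have OI: "p \<in> Op x" if "openin X U" "p \<in> U" "U \<lesssim> ?F x" for p U x using that by (auto simp: Op_def)
  have OE: "\<exists>U. openin X U \<and> p \<in> U \<and> U \<lesssim> ?F x" if "p \<in> Op x" for p x using that by (auto simp: Op_def)
  have PO: "p \<in> (\<Union>x\<in>M. Op x)" if p: "p \<in> P" for p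
  proof -
    obtain U where U: "openin X U" "p \<in> U" "U \<prec> M" using PM[OF p] by blast
    obtain x where "x \<in> M" "U \<approx> ?F x" by (rule lesspoll_card_less[OF U(3)])
    then show ?thesis using OI[OF U(1,2) eqpoll_imp_lepoll] by blast
  qed
  define lev where "lev = cover_index M Op"
  have levM: "lev p \<in> M" and levO: "p \<in> Op (lev p)"
    and levmin: "\<And>x. x \<in> M \<Longrightarrow> p \<in> Op x \<Longrightarrow> x = lev p \<or> (lev p, x) \<in> card_less M" if "p \<in> P" for p
    using cover_index[OF PO[OF that]] unfolding lev_def by blast+
  have levbig: "?F (lev p) \<lesssim> U" if p: "p \<in> P" and U: "openin X U" "p \<in> U" for p U
  proof (rule ccontr)
    assume "\<not> ?F (lev p) \<lesssim> U"
    then have less: "U \<prec> ?F (lev p)" by (simp add: not_lepoll)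
    have "U \<prec> M" by (rule lesspoll_trans[OF less card_less_lesspoll[OF levM[OF p]]])
    then obtain x where x: "x \<in> M" "U \<approx> ?F x" by (rule lesspoll_card_less)
    have "x = lev p \<or> (lev p, x) \<in> card_less M"
      using levmin[OF p x(1)] OI[OF U eqpoll_imp_lepoll[OF x(2)]] by blast
    then have "?F (lev p) \<subseteq> ?F x" by (auto intro: transD[OF strict_woD(2)[OF strict_wo_card_less]])
    then have "?F (lev p) \<lesssim> ?F x" by (rule subset_imp_lepoll)
    then have "?F (lev p) \<lesssim> U" using eqpoll_sym[OF x(2)] by (rule lepoll_trans2)
    then show False using less not_lepoll by metis
  qed
  \<comment> \<open>On a fibre each point has a neighbourhood of size at most \<open>|?F x|\<close>
    and none that is smaller, so \<open>?F x\<close> serves as the set of labels. It is at least as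
    large as \<open>C\<close> since neighbourhoods in \<open>Q1\<close> have at least
    \<open>|S|\<close> points.\<close>
  have fib: "noetherian_on X {p\<in>Q1. lev p = x}" if x: "x \<in> M" for x
  proof (cases "{p\<in>Q1. lev p = x} = {}")
    case True
    then have "{p\<in>Q1. lev p = x} \<subseteq> H" by (simp only: empty_subsetI)
    then show ?thesis by (rule noetherian_on_subset[OF H])
  next
    case False
    then obtain q where q: "q \<in> Q1" "lev q = x" by blast
    then have qP: "q \<in> P" using Q1Q QP by blast
    obtain U where U: "openin X U" "q \<in> U" "U \<lesssim> ?F x" using OE[OF levO[OF qP]] q(2) by blast
    have "C \<lesssim> S" by (rule lesspoll_imp_lepoll[OF S(2)])
    also have "S \<lesssim> U" by (rule Q1big[OF q(1) U(1,2)])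
    also have "U \<lesssim> ?F x" by fact
    finally have CF: "C \<lesssim> ?F x" .
    show ?thesis
    proof (rule noetherian_on_small_spread[OF X _ infinite_lepoll[OF iC CF] lepoll_trans[OF NC CF] lepoll_trans[OF powC CF]])
      show "{p\<in>Q1. lev p = x} \<subseteq> topspace X" using Q1Q QP P by blast
      show "?F x \<lesssim> U" if "p \<in> {p\<in>Q1. lev p = x}" "openin X U" "p \<in> U" for p U
        using levbig[of p U] that Q1Q QP by auto
      fix p assume "p \<in> {p\<in>Q1. lev p = x}"
      then have p: "p \<in> Q" "p \<in> Op x" using Q1Q QP levO by auto
      obtain U where U: "openin X U" "p \<in> U" "U \<lesssim> ?F x" using OE[OF p(2)] by blast
      show "\<exists>G. openin X G \<and> p \<in> G \<and> G \<lesssim> ?F x \<and> \<not> (\<exists>D\<subseteq>G. discrete_in X D \<and> D \<approx> N)"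
        by (rule loc2[OF p(1) U])
    qed
  qed
  have Q1: "noetherian_on X Q1"
  proof (rule noetherian_on_merge[OF X _ iS S(2), where lev=lev and M=M and N=N])
    show "Q1 \<subseteq> topspace X" using Q1Q QP P by blast
    show "Pow A \<lesssim> C" if A: "A \<prec> N" for A :: "'a set"
    proof -
      obtain x where x: "x \<in> N" "A \<approx> ?FN x" by (rule lesspoll_card_less[OF A])
      have "Pow A \<lesssim> Pow (?FN x)" by (rule Pow_lepoll_mono[OF eqpoll_imp_lepoll[OF x(2)]])
      then show ?thesis using powC[OF x(1)] by (rule lepoll_trans)
    qed
    show "S \<lesssim> U" if "p \<in> Q1" "openin X U" "p \<in> U" for p U by (rule Q1big[OF that])
    show "lev p \<in> M" if "p \<in> Q1" for p using levM that Q1Q QP by blast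
    show "noetherian_on X {p\<in>Q1. lev p = x}" if "x \<in> M" for x by (rule fib[OF that])
    fix p assume p: "p \<in> Q1"
    then have pP: "p \<in> P" "p \<in> Q" using Q1Q QP by blast+
    obtain U where U: "openin X U" "p \<in> U" "U \<lesssim> ?F (lev p)" using OE[OF levO[OF pP(1)]] by blast
    obtain G where G: "openin X G" "p \<in> G" "\<not> (\<exists>D\<subseteq>G. discrete_in X D \<and> D \<approx> N)" using Qloc[OF pP(2)] by blast
    show "\<exists>G. openin X G \<and> p \<in> G \<and> \<not> (\<exists>D\<subseteq>G. discrete_in X D \<and> D \<approx> N) \<and>
      (\<forall>q\<in>G \<inter> Q1. lev q = lev p \<or> (lev q, lev p) \<in> card_less M)"
    proof (intro exI[of _ "U \<inter> G"] conjI ballI)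
      show "openin X (U \<inter> G)" "p \<in> U \<inter> G" using U G by auto
      show "\<not> (\<exists>D\<subseteq>U \<inter> G. discrete_in X D \<and> D \<approx> N)" using G(3) by blast
      fix q assume q: "q \<in> U \<inter> G \<inter> Q1"
      then have "q \<in> P" "q \<in> Op (lev p)" using Q1Q QP OI[OF U(1) _ U(3), of q] by auto
      then show "lev q = lev p \<or> (lev q, lev p) \<in> card_less M"
        using levmin[OF _ levM[OF pP(1)], of q] by auto
    qed
  qed
  have "noetherian_on X (((locally_less X C \<union> H) \<union> (Q \<inter> locally_less X S)) \<union> Q1)"
    by (intro noetherian_on_Un IH[OF CM] H Q0 Q1)
  then show ?thesis by (rule noetherian_on_subset) (auto simp: Q1_def Q_def P_def)
qed

lemma noetherian_on_locally_less:
  fixes M :: "'c set"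
  assumes X: "t1_space X" "regular_space X"
    and M: "\<forall>N :: 'c set. N \<lesssim> M \<and> (UNIV :: nat set) \<prec> N \<and> regularCard |N| \<longrightarrow>
      (\<exists>L :: 'c set. L \<prec> N \<and> N \<lesssim> Pow L)"
  shows "noetherian_on X (locally_less X M)"
  using M
proof (induction M rule: wf_induct_rule[OF wf_lesspoll])
  case (1 M)
  have IH: "noetherian_on X (locally_less X N)" if N: "N \<prec> M" for N :: "'c set"
  proof -
    have "N' \<lesssim> M" if "N' \<lesssim> N" for N' :: "'c set"
      by (rule lepoll_trans[OF that lesspoll_imp_lepoll[OF N]])
    then have "\<forall>N' :: 'c set. N' \<lesssim> N \<and> (UNIV :: nat set) \<prec> N' \<and> regularCard |N'| \<longrightarrow>
      (\<exists>L :: 'c set. L \<prec> N' \<and> N' \<lesssim> Pow L)" using 1(2) by simp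
    then show ?thesis using 1(1) N by simp
  qed
  show ?case
  proof (cases "M \<lesssim> (UNIV :: nat set)")
    case True
    then show ?thesis by (rule noetherian_on_locally_finite[OF X(1)])
  next
    case False
    then have u: "(UNIV :: nat set) \<prec> M" by (simp add: not_lepoll)
    show ?thesis
    proof (cases "regularCard |M|")
      case True
      obtain L :: "'c set" where L: "L \<prec> M" "M \<lesssim> Pow L" using spec[OF 1(2), of M] u True lepoll_refl[of M] by blast
      have "infinite M" using u infinite_le_lepoll lesspoll_imp_lepoll by metis
      show ?thesis by (rule noetherian_on_regular_limit[OF X IH \<open>infinite M\<close> True L])
    next
      case False
      show ?thesis by (rule noetherian_on_singular[OF X(1) IH u False])
    qed
  qed
qed

theorem theorem4:
  fixes X :: "'a topology" and mu :: "'b rel"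
  assumes "T3_space X"
    and "Card_order mu"
    and "\<forall>p\<in>topspace X. \<exists>G. openin X G \<and> p \<in> G \<and> (card_of G, mu) \<in> ordLeq"
    and "\<forall>k :: 'b rel. Card_order k \<and> (k, mu) \<in> ordLeq \<longrightarrow> \<not> strongly_inaccessible k"
  shows "\<exists>B. noetherian_base X B"
proof -
  have X: "t1_space X" "regular_space X" using assms(1) by (simp_all add: T3_space_def)
  \<comment> \<open>The successor turns the bound "at most \<open>mu\<close>" into "fewer than
    \<open>|M|\<close>". Its elements have type \<open>'b set\<close>, one type above those of
    \<open>mu\<close>.\<close>
  define M where "M = Field (cardSuc mu)"
  have Mmu: "|M| =o cardSuc mu"
    unfolding M_def by (rule card_of_Field_ordIso[OF cardSuc_Card_order[OF assms(2)]])
  have lessM: "A \<prec> M \<longleftrightarrow> |A| \<le>o mu" for A :: "'z set"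
  proof -
    have "A \<prec> M \<longleftrightarrow> |A| <o cardSuc mu"
      unfolding lesspoll_iff_card_of using Mmu ordIso_symmetric ordLess_ordIso_trans by metis
    then show ?thesis using cardSuc_ordLeq_ordLess[OF assms(2) card_of_Card_order] by metis
  qed
  have top: "locally_less X M = topspace X"
    using assms(3) lessM unfolding locally_less_def by auto
  \<comment> \<open>Singletons copy sets over \<open>'b\<close> to sets over \<open>'b set\<close>,
    where the induction takes place.\<close>
  have sing: "A \<approx> (\<lambda>x. {x}) ` A" for A :: "'b set"
    by (rule eqpoll_sym[OF inj_on_image_eqpoll_self]) (simp add: inj_on_def)
  have mu: "|Field mu| =o mu" by (rule card_of_Field_ordIso[OF assms(2)])
  have "\<exists>L :: 'b set set. L \<prec> N \<and> N \<lesssim> Pow L"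
    if N: "N \<lesssim> M" "(UNIV :: nat set) \<prec> N" "regularCard |N|" for N :: "'b set set"
  proof (rule ccontr)
    assume "\<not> ?thesis"
    then have lim: "Pow L \<prec> N" if "L \<prec> N" for L :: "'b set set" using that not_lepoll by metis
    have iN: "infinite N" using N(2) infinite_le_lepoll lesspoll_imp_lepoll by metis
    show False
    proof (cases "|N| \<le>o mu")
      case True
      \<comment> \<open>Moved into the field of \<open>mu\<close>, the set \<open>N\<close> becomes
        a cardinal on \<open>'b\<close>, to which the hypothesis on inaccessibles applies.\<close>
      then obtain B where B: "B \<subseteq> Field mu" "|N| =o |B|" "|B| \<le>o mu" using iffD1[OF internalize_card_of_ordLeq True] by blast
      have NB: "N \<approx> B" using B(2) by (simp add: eqpoll_iff_card_of_ordIso)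
      have "strongly_inaccessible |B|" unfolding strongly_inaccessible_def
      proof (intro conjI allI impI)
        show "Card_order |B|" by (rule card_of_Card_order)
        show "(card_of (UNIV :: nat set), |B| ) \<in> ordLess"
          using lesspoll_eq_trans[OF N(2) NB] unfolding lesspoll_iff_card_of .
        show "regularCard |B|" by (rule regularCard_ordIso[OF B(2) Cinfinite_card_of[OF iN] N(3)])
        fix L :: "'b set" assume "( |L|, |B| ) \<in> ordLess"
        then have "L \<prec> B" by (simp add: lesspoll_iff_card_of)
        then have "(\<lambda>x. {x}) ` L \<prec> N"
          by (rule eq_lesspoll_trans[OF eqpoll_sym[OF sing] lesspoll_eq_trans[OF _ eqpoll_sym[OF NB]]])
        then have "Pow ((\<lambda>x. {x}) ` L) \<prec> N" by (rule lim)
        moreover have "Pow L \<lesssim> Pow ((\<lambda>x. {x}) ` L)"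
          by (rule Pow_lepoll_mono[OF eqpoll_imp_lepoll[OF sing]])
        ultimately have "Pow L \<prec> N" by (rule lesspoll_trans1[rotated])
        then have "Pow L \<prec> B" using NB by (rule lesspoll_eq_trans)
        then show "( |Pow L|, |B| ) \<in> ordLess" by (simp add: lesspoll_iff_card_of)
      qed
      then show False using assms(4) B(3) card_of_Card_order by blast
    next
      case False
      \<comment> \<open>Here \<open>N\<close> has the size of the successor of \<open>mu\<close>. It
        is no strong limit: 2^mu below it would be at most \<open>mu\<close>, against Cantor's
        theorem.\<close>
      let ?L = "(\<lambda>x. {x}) ` Field mu"
      have "Well_order mu" using assms(2) by (simp add: card_order_on_def)
      from iffD1[OF not_ordLeq_iff_ordLess[OF this card_of_Well_order] False]
      have "mu <o |N|" .
      then have "Field mu \<prec> N" unfolding lesspoll_iff_card_of using mu ordIso_ordLess_trans by blast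
      then have "?L \<prec> N" by (rule eq_lesspoll_trans[OF eqpoll_sym[OF sing]])
      then have "Pow ?L \<prec> N" by (rule lim)
      then have "Pow ?L \<prec> M" using N(1) by (rule lesspoll_trans2)
      then have "|Pow ?L| \<le>o mu" using lessM by blast
      then have "Pow ?L \<lesssim> Field mu" unfolding lepoll_iff_card_of
        using mu ordIso_symmetric ordLeq_ordIso_trans by blast
      then have "Pow ?L \<lesssim> ?L" using sing by (rule lepoll_trans2)
      then show False using lesspoll_Pow_self not_lepoll by metis
    qed
  qed
  then have "noetherian_on X (locally_less X M)" by (intro noetherian_on_locally_less[OF X]) simp
  then show ?thesis unfolding top by (rule noetherian_base_if_noetherian_on_topspace)
qed

end
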